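(* Let $\tau\in T_{\mathcal F}$ be regular, i.e. $w.\tau\neq\tau$ for all $w\in W^v\setminus\{1\}$. Then $I_\tau$ is irreducible (as a ${}^{BL}\mathcal H_{\mathcal F}$-module) if and only if $\tau\in\mathcal U_{\mathcal F}$.
   Context: Let $\mathcal S=(A,X,Y,(\alpha_i)_{i\in I},(\alpha_i^\vee)_{i\in I})$ be a root generating system: $A=(a_{i,j})$ is a Kac–Moody matrix (finite index set $I$, integer entries, $a_{i,i}=2$, $a_{i,j}\le 0$ for $i\ne j$, $a_{i,j}=0\iff a_{j,i}=0$), $X,Y$ are dual free $\mathbb Z$-modules of finite rank, $(\alpha_i)$ and $(\alpha_i^\vee)$ are free families in $X$ and $Y$ with $\alpha_j(\alpha_i^\vee)=a_{i,j}$. Put $\mathbb A=Y\otimes\mathbb R$, $r_i(v)=v-\alpha_i(v)\alpha_i^\vee$, $\mathscr S=\{r_i\}$, $W^v=\langle\mathscr S\rangle\subset GL(\mathbb A)$ (Coxeter group with length $\ell$); for $s=r_i$ write $\alpha_s=\alpha_i$, $\alpha_s^\vee=\alpha_i^\vee$. $\Phi^\vee=\{w.\alpha_s^\vee\mid w\in W^v,s\in\mathscr S\}$. $\mathcal F$ is a field of characteristic $0$ and $(\sigma_s)_{s\in\mathscr S},(\sigma'_s)_{s\in\mathscr S}$ are families in $\mathcal F^*$ such that $\sigma_s=\sigma'_s$ if $\alpha_s(Y)=\mathbb Z$, and $\sigma_s=\sigma_t=\sigma'_s=\sigma'_t$ for $s\ne t$ with $st$ of finite odd order. Standing assumption: $\sigma'_s\notin\{\sigma_s^{-1},-\sigma_s,-\sigma_s^{-1}\}$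 for all $s\in\mathscr S$. ${}^{BL}\mathcal H_{\mathcal F}$ is the $\mathcal F$-vector space with basis $(Z^\lambda H_w)_{\lambda\in Y,w\in W^v}$ ($Z^\lambda=Z^\lambda H_1$, $H_w=Z^0H_w$) with the unique associative product such that $Z^\lambda*H_w=Z^\lambda H_w$; $Z^\lambda*Z^\mu=Z^{\lambda+\mu}$; $H_s*H_w=H_{sw}$ if $\ell(sw)=\ell(w)+1$ and $H_s*H_w=(\sigma_s-\sigma_s^{-1})H_w+H_{sw}$ if $\ell(sw)=\ell(w)-1$; and $H_s*Z^\lambda-Z^{s.\lambda}*H_s=Q_s(Z)(Z^\lambda-Z^{s.\lambda})$ with $Q_s(Z)=\frac{(\sigma_s-\sigma_s^{-1})+(\sigma_s'-\sigma_s'^{-1})Z^{-\alpha_s^\vee}}{1-Z^{-2\alpha_s^\vee}}$. $\mathcal F[Y]=\bigoplus_\lambda\mathcal FZ^\lambda$, with fraction field $\mathcal F(Y)$; $W^v$ acts on both by $(Z^\lambda)^w=Z^{w.\lambda}$. $T_{\mathcal F}=\mathrm{Hom}_{\mathrm{Gr}}(Y,\mathcal F^* )$, with $(w.\tau)(\lambda)=\tau(w^{-1}.\lambda)$; $\tau\in T_{\mathcal F}$ is extended to an algebra morphism $\mathcal F[Y]\to\mathcal F$, $Z^\lambda\mapsto\tau(\lambda)$; $I_\tau={}^{BL}\mathcal H_{\mathcal F}\otimes_{\mathcal F[Y]}\mathcal F$, $\mathcal F[Y]$ acting on $\mathcal F$ via $\tau$. For $s\in\mathscr S$, $\zeta_s=-\sigma_sQ_s(Z)+\sigma_s^2\in\mathcal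 F(Y)$; for $\alpha^\vee=w.\alpha_s^\vee\in\Phi^\vee$, $\zeta_{\alpha^\vee}=(\zeta_s)^w$ (well defined). Write $\zeta_{\alpha^\vee}=\zeta^{\mathrm{num}}_{\alpha^\vee}/\zeta^{\mathrm{den}}_{\alpha^\vee}$ with coprime $\zeta^{\mathrm{num}}_{\alpha^\vee},\zeta^{\mathrm{den}}_{\alpha^\vee}$ in the UFD $\mathcal F[Y]$. $\mathcal U_{\mathcal F}=\{\tau\in T_{\mathcal F}\mid\tau(\zeta^{\mathrm{num}}_{\alpha^\vee})\ne0\ \forall\alpha^\vee\in\Phi^\vee\}$. (If $\sigma_s=\sigma'_s=\sqrt q$ for all $s$, then $\mathcal U_{\mathcal F}=\{\tau\mid\tau(\alpha^\vee)\neq q\ \forall\alpha^\vee\in\Phi^\vee\}$.) *)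

theory Defs
  imports
    "HOL-Library.Poly_Mapping"
    "HOL-Computational_Algebra.Fraction_Field"
    "HOL-Computational_Algebra.Polynomial_Factorial"
begin

section \<open>Free abelian groups of finite rank\<close>

context ab_group_add
begin

text \<open>One of the two sums is empty, so this is the integer multiple \<open>k \<cdot> y\<close>.\<close>

definition zsmult :: "int \<Rightarrow> 'a \<Rightarrow> 'a" where
  "zsmult k y = (\<Sum>i<nat k. y) - (\<Sum>i<nat (- k). y)"

definition is_int_basis :: "'a set \<Rightarrow> bool" where
  "is_int_basis B \<longleftrightarrow> finite B \<and>
     (\<forall>y. \<exists>!c :: 'a \<Rightarrow> int. (\<forall>b. b \<notin> B \<longrightarrow> c b = 0) \<and> y = (\<Sum>b\<in>B. zsmult (c b) b))"

end

class fg_free_abelian = ab_group_add +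
  assumes ex_int_basis: "\<exists>B. is_int_basis B"

definition int_free_family :: "'i set \<Rightarrow> ('i \<Rightarrow> 'a::ab_group_add) \<Rightarrow> bool" where
  "int_free_family I v \<longleftrightarrow>
     (\<forall>c :: 'i \<Rightarrow> int. (\<Sum>i\<in>I. zsmult (c i) (v i)) = 0 \<longrightarrow> (\<forall>i\<in>I. c i = 0))"

lemma zsmult_0 [simp]: "zsmult 0 y = 0"
  by (simp add: zsmult_def)

lemma zsmult_diff_of_nat:
  fixes y :: "'a::ab_group_add"
  shows "zsmult (int a - int b) y = (\<Sum>i<a. y) - (\<Sum>i<b. y)"
proof (cases "b \<le> a")
  case True
  then obtain c where "a = b + c" using le_Suc_ex by blast
  moreover have "(\<Sum>i<b + c. y) = (\<Sum>i<b. y) + (\<Sum>i<c. y)" for c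
    by (induction c) (simp_all add: algebra_simps)
  ultimately show ?thesis by (simp add: zsmult_def)
next
  case False
  then obtain c where "b = a + c" using le_Suc_ex nat_le_linear by blast
  moreover have "(\<Sum>i<a + c. y) = (\<Sum>i<a. y) + (\<Sum>i<c. y)" for c
    by (induction c) (simp_all add: algebra_simps)
  ultimately show ?thesis by (simp add: zsmult_def)
qed

lemma zsmult_add_left:
  fixes y :: "'a::ab_group_add"
  shows "zsmult (k + l) y = zsmult k y + zsmult l y"
proof -
  have sum_add: "(\<Sum>i<a + c. y) = (\<Sum>i<a. y) + (\<Sum>i<c. y)" for a c :: nat
    by (induction c) (simp_all add: algebra_simps)
  obtain a b where k: "k = int a - int b" by (rule int_diff_cases)
  obtain c d where l: "l = int c - int d" by (rule int_diff_cases)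
  have "k + l = int (a + c) - int (b + d)" by (simp add: k l)
  then show ?thesis
    unfolding k l by (simp only: zsmult_diff_of_nat sum_add) (simp add: algebra_simps)
qed

text \<open>The coordinates of a basis give an embedding into an ordered group; it is only used to see
  that the group algebra has no zero divisors.\<close>

lemma ex_ordered_embedding:
  obtains \<phi> :: "'a::fg_free_abelian \<Rightarrow> (nat \<Rightarrow>\<^sub>0 int)"
  where "inj \<phi>" and "\<And>x y. \<phi> (x + y) = \<phi> x + \<phi> y"
proof -
  obtain B :: "'a set" where B: "is_int_basis B" using ex_int_basis by blast
  then have fin: "finite B" by (simp add: is_int_basis_def)
  define P where "P y c \<longleftrightarrow> (\<forall>b. b \<notin> B \<longrightarrow> c b = 0) \<and> y = (\<Sum>b\<in>B. zsmult (c b) b)"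
    for y :: 'a and c :: "'a \<Rightarrow> int"
  have ex1: "\<exists>!c. P y c" for y using B by (simp add: is_int_basis_def P_def)
  define c where "c y = (THE c. P y c)" for y
  have Pc: "P y (c y)" for y unfolding c_def using theI'[OF ex1] .
  have c_add: "c (x + y) = (\<lambda>b. c x b + c y b)" for x y
  proof -
    have "P (x + y) (\<lambda>b. c x b + c y b)"
      using Pc[of x] Pc[of y] by (simp add: P_def zsmult_add_left sum.distrib)
    then show ?thesis using ex1 Pc by blast
  qed
  obtain e :: "'a \<Rightarrow> nat" where e: "inj_on e B"
    using fin finite_imp_inj_to_nat_seg by metis
  define \<phi> where "\<phi> y = (\<Sum>b\<in>B. Poly_Mapping.single (e b) (c y b))" for y
  have lookup: "Poly_Mapping.lookup (\<phi> y) (e b) = c y b" if "b \<in> B" for y b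
  proof -
    have "Poly_Mapping.lookup (\<phi> y) (e b) = (\<Sum>b'\<in>B. if b' = b then c y b' else 0)"
      unfolding \<phi>_def lookup_sum
      by (rule sum.cong) (use e that in \<open>auto simp: lookup_single when_def dest: inj_onD\<close>)
    then show ?thesis using fin that by simp
  qed
  have "inj \<phi>"
  proof (rule injI)
    fix x y assume "\<phi> x = \<phi> y"
    then have "c x b = c y b" for b
      using lookup[of b x] lookup[of b y] Pc[of x] Pc[of y] by (cases "b \<in> B") (auto simp: P_def)
    then show "x = y" using Pc[of x] Pc[of y] by (simp add: P_def)
  qed
  moreover have "\<phi> (x + y) = \<phi> x + \<phi> y" for x y
    by (simp add: \<phi>_def c_add single_add sum.distrib)
  ultimately show thesis using that by blast
qed

section \<open>The group algebra and its fraction field\<close>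

text \<open>A copy of \<open>'y \<Rightarrow>\<^sub>0 'f\<close>: the library proves that type to be an integral domain for
  linearly ordered \<open>'y\<close> only, and a type constructor cannot have a second \<open>idom\<close> instance.\<close>

typedef (overloaded) ('y, 'f) group_algebra = "UNIV :: ('y \<Rightarrow>\<^sub>0 'f::zero) set"
  morphisms ga_coeffs Abs_ga ..

setup_lifting type_definition_group_algebra

instantiation group_algebra :: (comm_monoid_add, comm_ring_1) comm_ring_1
begin

lift_definition zero_group_algebra :: "('a, 'b) group_algebra" is 0 .
lift_definition one_group_algebra :: "('a, 'b) group_algebra" is 1 .
lift_definition plus_group_algebra ::
  "('a, 'b) group_algebra \<Rightarrow> ('a, 'b) group_algebra \<Rightarrow> ('a, 'b) group_algebra" is "(+)" .
lift_definition minus_group_algebra ::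
  "('a, 'b) group_algebra \<Rightarrow> ('a, 'b) group_algebra \<Rightarrow> ('a, 'b) group_algebra" is "(-)" .
lift_definition uminus_group_algebra ::
  "('a, 'b) group_algebra \<Rightarrow> ('a, 'b) group_algebra" is uminus .
lift_definition times_group_algebra ::
  "('a, 'b) group_algebra \<Rightarrow> ('a, 'b) group_algebra \<Rightarrow> ('a, 'b) group_algebra" is "(*)" .

instance
  by standard (transfer; simp add: algebra_simps)+

end

lemma poly_mapping_mult_nonzero:
  fixes f g :: "'y::fg_free_abelian \<Rightarrow>\<^sub>0 'f::idom"
  assumes "f \<noteq> 0" and "g \<noteq> 0"
  shows "f * g \<noteq> 0"
proof -
  obtain \<phi> :: "'y \<Rightarrow> (nat \<Rightarrow>\<^sub>0 int)"
    where inj: "inj \<phi>" and add: "\<And>x y. \<phi> (x + y) = \<phi> x + \<phi> y"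
    using ex_ordered_embedding by metis
  have diff: "\<phi> (x - y) = \<phi> x - \<phi> y" for x y
    using add[of "x - y" y] by (simp add: algebra_simps)
  have lead: "\<exists>a\<in>Poly_Mapping.keys h. \<forall>k\<in>Poly_Mapping.keys h. \<phi> k \<le> \<phi> a"
    if "h \<noteq> 0" for h :: "'y \<Rightarrow>\<^sub>0 'f"
  proof -
    have "Max (\<phi> ` Poly_Mapping.keys h) \<in> \<phi> ` Poly_Mapping.keys h"
      using that by (intro Max_in) auto
    then obtain a where "a \<in> Poly_Mapping.keys h" "\<phi> a = Max (\<phi> ` Poly_Mapping.keys h)" by auto
    then show ?thesis by (intro bexI[of _ a]) auto
  qed
  obtain a where a: "a \<in> Poly_Mapping.keys f" "\<forall>k\<in>Poly_Mapping.keys f. \<phi> k \<le> \<phi> a"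
    using lead[OF assms(1)] by blast
  obtain b where b: "b \<in> Poly_Mapping.keys g" "\<forall>k\<in>Poly_Mapping.keys g. \<phi> k \<le> \<phi> b"
    using lead[OF assms(2)] by blast
  have inner: "(\<Sum>q. Poly_Mapping.lookup g q when k = l + q) = Poly_Mapping.lookup g (k - l)"
    for k l
  proof -
    have "(\<lambda>q. Poly_Mapping.lookup g q when k = l + q)
        = (\<lambda>q. Poly_Mapping.lookup g q when q = k - l)"
      by (auto simp: fun_eq_iff when_def algebra_simps)
    then show ?thesis by (simp only: Sum_any_when_equal)
  qed
  have zero: "l = a" if "Poly_Mapping.lookup f l * Poly_Mapping.lookup g (a + b - l) \<noteq> 0" for l
  proof -
    have "l \<in> Poly_Mapping.keys f" "a + b - l \<in> Poly_Mapping.keys g"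
      using that by (auto simp: in_keys_iff)
    then have "\<phi> l \<le> \<phi> a" "\<phi> (a + b - l) \<le> \<phi> b" using a b by auto
    then have "\<phi> l = \<phi> a" by (simp add: diff add algebra_simps)
    then show ?thesis using inj by (simp add: inj_eq)
  qed
  have "(\<lambda>l. Poly_Mapping.lookup f l * Poly_Mapping.lookup g (a + b - l))
      = (\<lambda>l. Poly_Mapping.lookup f l * Poly_Mapping.lookup g (a + b - l) when l = a)"
    using zero by (auto simp: fun_eq_iff when_def)
  then have "Poly_Mapping.lookup (f * g) (a + b)
      = (\<Sum>l. Poly_Mapping.lookup f l * Poly_Mapping.lookup g (a + b - l) when l = a)"
    by (simp only: lookup_mult inner)
  also have "\<dots> = Poly_Mapping.lookup f a * Poly_Mapping.lookup g b" by simp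
  also have "\<dots> \<noteq> 0" using a b by (simp add: in_keys_iff)
  finally show ?thesis by auto
qed

instance group_algebra :: (fg_free_abelian, idom) idom
  by standard (transfer, rule poly_mapping_mult_nonzero)

text \<open>Division is exact division where that is possible; it is needed only because the library
  introduces \<open>coprime\<close> for domains with a division operation.\<close>

instantiation group_algebra :: (fg_free_abelian, idom) idom_divide
begin

definition divide_group_algebra ::
  "('a, 'b) group_algebra \<Rightarrow> ('a, 'b) group_algebra \<Rightarrow> ('a, 'b) group_algebra" where
  "divide_group_algebra p q = (if q \<noteq> 0 \<and> q dvd p then (THE r. p = r * q) else 0)"

instance
proof
  fix p q :: "('a, 'b) group_algebra"
  assume "q \<noteq> 0"
  then show "p * q div q = p" by (auto simp: divide_group_algebra_def)
qed (simp add: divide_group_algebra_def)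

end

instance group_algebra :: (fg_free_abelian, idom) algebraic_semidom ..

lift_definition ga_const :: "'f \<Rightarrow> ('y::zero, 'f::zero) group_algebra" is
  "Poly_Mapping.single 0" .

lift_definition ga_Z :: "'y \<Rightarrow> ('y, 'f::zero_neq_one) group_algebra" is
  "\<lambda>\<mu>. Poly_Mapping.single \<mu> 1" .

definition ga_supp :: "('y, 'f::zero) group_algebra \<Rightarrow> 'y set" where
  "ga_supp p = Poly_Mapping.keys (ga_coeffs p)"

definition ga_coeff :: "('y, 'f::zero) group_algebra \<Rightarrow> 'y \<Rightarrow> 'f" where
  "ga_coeff p = Poly_Mapping.lookup (ga_coeffs p)"

definition ga_act ::
  "('y \<Rightarrow> 'y) \<Rightarrow> ('y::comm_monoid_add, 'f::comm_ring_1) group_algebra \<Rightarrow> ('y, 'f) group_algebra"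
where
  "ga_act w p = (\<Sum>\<mu>\<in>ga_supp p. ga_const (ga_coeff p \<mu>) * ga_Z (w \<mu>))"

definition fract_act ::
  "('y \<Rightarrow> 'y) \<Rightarrow> ('y::fg_free_abelian, 'f::idom) group_algebra fract
    \<Rightarrow> ('y, 'f) group_algebra fract" where
  "fract_act w q = (THE r. \<exists>a b. b \<noteq> 0 \<and> q = Fract a b \<and> r = Fract (ga_act w a) (ga_act w b))"

section \<open>Root generating systems and their Weyl groups\<close>

record ('i, 'x, 'y) root_data =
  index :: "'i set"
  cartan :: "'i \<Rightarrow> 'i \<Rightarrow> int"
  pairing :: "'x \<Rightarrow> 'y \<Rightarrow> int"
  simple_root :: "'i \<Rightarrow> 'x"
  simple_coroot :: "'i \<Rightarrow> 'y"

definition kac_moody_matrix :: "'i set \<Rightarrow> ('i \<Rightarrow> 'i \<Rightarrow> int) \<Rightarrow> bool" where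
  "kac_moody_matrix I a \<longleftrightarrow> finite I \<and> (\<forall>i\<in>I. a i i = 2) \<and>
     (\<forall>i\<in>I. \<forall>j\<in>I. i \<noteq> j \<longrightarrow> a i j \<le> 0) \<and>
     (\<forall>i\<in>I. \<forall>j\<in>I. a i j = 0 \<longleftrightarrow> a j i = 0)"

definition perfect_pairing :: "('x::ab_group_add \<Rightarrow> 'y::ab_group_add \<Rightarrow> int) \<Rightarrow> bool" where
  "perfect_pairing p \<longleftrightarrow>
     bij_betw p UNIV {f. additive f} \<and> bij_betw (\<lambda>y x. p x y) UNIV {f. additive f}"

definition root_generating_system ::
  "('i, 'x::fg_free_abelian, 'y::fg_free_abelian) root_data \<Rightarrow> bool" where
  "root_generating_system S \<longleftrightarrow>
     kac_moody_matrix (index S) (cartan S) \<and>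
     perfect_pairing (pairing S) \<and>
     int_free_family (index S) (simple_root S) \<and> int_free_family (index S) (simple_coroot S) \<and>
     (\<forall>i\<in>index S. \<forall>j\<in>index S. pairing S (simple_root S j) (simple_coroot S i) = cartan S i j)"

definition simple_refl :: "('i, 'x, 'y::ab_group_add) root_data \<Rightarrow> 'i \<Rightarrow> 'y \<Rightarrow> 'y" where
  "simple_refl S i v = v - zsmult (pairing S (simple_root S i) v) (simple_coroot S i)"

definition refl_word :: "('i, 'x, 'y::ab_group_add) root_data \<Rightarrow> 'i list \<Rightarrow> 'y \<Rightarrow> 'y" where
  "refl_word S is = foldr (\<lambda>i f. simple_refl S i \<circ> f) is id"

text \<open>The simple reflections act on \<open>Y \<otimes> \<real>\<close> through their restrictions to the spanning lattice
  \<open>Y\<close>, so \<open>W\<^sup>v\<close> is taken as a group of automorphisms of \<open>Y\<close>. The generators are involutions,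
  hence the generated group consists of the products of generators.\<close>

definition weyl :: "('i, 'x, 'y::ab_group_add) root_data \<Rightarrow> ('y \<Rightarrow> 'y) set" where
  "weyl S = refl_word S ` lists (index S)"

definition len :: "('i, 'x, 'y::ab_group_add) root_data \<Rightarrow> ('y \<Rightarrow> 'y) \<Rightarrow> nat" where
  "len S w = (LEAST n. \<exists>is\<in>lists (index S). length is = n \<and> refl_word S is = w)"

definition coroots :: "('i, 'x, 'y::ab_group_add) root_data \<Rightarrow> 'y set" where
  "coroots S = {w (simple_coroot S i) | w i. w \<in> weyl S \<and> i \<in> index S}"

definition has_odd_order :: "('a \<Rightarrow> 'a) \<Rightarrow> bool" where
  "has_odd_order f \<longleftrightarrow> (\<exists>n. odd n \<and> f ^^ n = id \<and> (\<forall>m. 0 < m \<and> m < n \<longrightarrow> f ^^ m \<noteq> id))"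

section \<open>The Bernstein--Lusztig Hecke algebra\<close>

text \<open>The simple reflections are indexed by \<open>index S\<close>: as the roots and the coroots form free
  families, \<open>i \<mapsto> simple_refl S i\<close> is injective on this set.\<close>

definition hecke_parameters ::
  "('i, 'x, 'y::ab_group_add) root_data \<Rightarrow> ('i \<Rightarrow> 'f::field) \<Rightarrow> ('i \<Rightarrow> 'f) \<Rightarrow> bool" where
  "hecke_parameters S \<sigma> \<sigma>' \<longleftrightarrow>
     (\<forall>i\<in>index S. \<sigma> i \<noteq> 0 \<and> \<sigma>' i \<noteq> 0) \<and>
     (\<forall>i\<in>index S. range (pairing S (simple_root S i)) = UNIV \<longrightarrow> \<sigma> i = \<sigma>' i) \<and>
     (\<forall>i\<in>index S. \<forall>j\<in>index S. i \<noteq> j \<and> has_odd_order (simple_refl S i \<circ> simple_refl S j) \<longrightarrow>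
        \<sigma> i = \<sigma> j \<and> \<sigma> j = \<sigma>' i \<and> \<sigma>' i = \<sigma>' j)"

definition Q_fract ::
  "('i, 'x, 'y::fg_free_abelian) root_data \<Rightarrow> ('i \<Rightarrow> 'f::field) \<Rightarrow> ('i \<Rightarrow> 'f) \<Rightarrow> 'i
    \<Rightarrow> ('y, 'f) group_algebra fract" where
  "Q_fract S \<sigma> \<sigma>' i =
     Fract (ga_const (\<sigma> i - inverse (\<sigma> i))
            + ga_const (\<sigma>' i - inverse (\<sigma>' i)) * ga_Z (- simple_coroot S i))
           (1 - ga_Z (zsmult (- 2) (simple_coroot S i)))"

definition ga_embed ::
  "('f \<Rightarrow> 'h \<Rightarrow> 'h) \<Rightarrow> ('y \<Rightarrow> ('y \<Rightarrow> 'y) \<Rightarrow> 'h) \<Rightarrow> ('y, 'f::zero) group_algebra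
    \<Rightarrow> 'h::comm_monoid_add" where
  "ga_embed scale ZH p = (\<Sum>\<mu>\<in>ga_supp p. scale (ga_coeff p \<mu>) (ZH \<mu> id))"

text \<open>The ring \<open>'h\<close>, with the scalar multiplication \<open>scale\<close>, is the algebra with basis
  \<open>ZH \<mu> w = Z\<^sup>\<mu> H\<^sub>w\<close> and the Bernstein--Lusztig relations. The last relation is read inside the
  fraction field: the right-hand side lies in the group algebra, and \<open>p\<close> is its value. That the
  algebra is unital is a consequence of the relations, the unit being \<open>ZH 0 id\<close>.\<close>

definition BL_hecke_algebra ::
  "('i, 'x, 'y::fg_free_abelian) root_data \<Rightarrow> ('i \<Rightarrow> 'f::field) \<Rightarrow> ('i \<Rightarrow> 'f)
    \<Rightarrow> ('f \<Rightarrow> 'h \<Rightarrow> 'h::ring_1) \<Rightarrow> ('y \<Rightarrow> ('y \<Rightarrow> 'y) \<Rightarrow> 'h) \<Rightarrow> bool" where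
  "BL_hecke_algebra S \<sigma> \<sigma>' scale ZH \<longleftrightarrow>
     vector_space scale \<and>
     (\<forall>c a b. scale c (a * b) = scale c a * b \<and> scale c (a * b) = a * scale c b) \<and>
     inj_on (\<lambda>(\<mu>, w). ZH \<mu> w) (UNIV \<times> weyl S) \<and>
     \<not> module.dependent scale ((\<lambda>(\<mu>, w). ZH \<mu> w) ` (UNIV \<times> weyl S)) \<and>
     module.span scale ((\<lambda>(\<mu>, w). ZH \<mu> w) ` (UNIV \<times> weyl S)) = UNIV \<and>
     (\<forall>\<mu>. \<forall>w\<in>weyl S. ZH \<mu> id * ZH 0 w = ZH \<mu> w) \<and>
     (\<forall>\<mu> \<nu>. ZH \<mu> id * ZH \<nu> id = ZH (\<mu> + \<nu>) id) \<and>
     (\<forall>i\<in>index S. \<forall>w\<in>weyl S.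
        (len S (simple_refl S i \<circ> w) = len S w + 1 \<longrightarrow>
           ZH 0 (simple_refl S i) * ZH 0 w = ZH 0 (simple_refl S i \<circ> w)) \<and>
        (len S w = len S (simple_refl S i \<circ> w) + 1 \<longrightarrow>
           ZH 0 (simple_refl S i) * ZH 0 w
             = scale (\<sigma> i - inverse (\<sigma> i)) (ZH 0 w) + ZH 0 (simple_refl S i \<circ> w))) \<and>
     (\<forall>i\<in>index S. \<forall>\<mu>. \<exists>p.
        to_fract p = Q_fract S \<sigma> \<sigma>' i * to_fract (ga_Z \<mu> - ga_Z (simple_refl S i \<mu>)) \<and>
        ZH 0 (simple_refl S i) * ZH \<mu> id - ZH (simple_refl S i \<mu>) id * ZH 0 (simple_refl S i)
          = ga_embed scale ZH p)"

section \<open>Tensor products and irreducible modules over noncommutative rings\<close>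

text \<open>\<open>M \<otimes>\<^sub>R N\<close> is the free abelian group on \<open>M \<times> N\<close> modulo the subgroup generated by the
  bilinearity and balancing relations; its elements are cosets. Here \<open>ra\<close> is the right action
  of \<open>R\<close> on \<open>M\<close> and \<open>la\<close> the left action on \<open>N\<close>.\<close>

inductive_set tensor_null ::
  "('m::ab_group_add \<Rightarrow> 'r \<Rightarrow> 'm) \<Rightarrow> ('r \<Rightarrow> 'n::ab_group_add \<Rightarrow> 'n) \<Rightarrow> (('m \<times> 'n) \<Rightarrow>\<^sub>0 int) set"
  for ra la where
  zero: "0 \<in> tensor_null ra la"
| diff: "x \<in> tensor_null ra la \<Longrightarrow> y \<in> tensor_null ra la \<Longrightarrow> x - y \<in> tensor_null ra la"
| add_left: "frag_of (m + m', n) - frag_of (m, n) - frag_of (m', n) \<in> tensor_null ra la"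
| add_right: "frag_of (m, n + n') - frag_of (m, n) - frag_of (m, n') \<in> tensor_null ra la"
| balanced: "frag_of (ra m r, n) - frag_of (m, la r n) \<in> tensor_null ra la"

definition tensor_coset ::
  "('m::ab_group_add \<Rightarrow> 'r \<Rightarrow> 'm) \<Rightarrow> ('r \<Rightarrow> 'n::ab_group_add \<Rightarrow> 'n)
    \<Rightarrow> (('m \<times> 'n) \<Rightarrow>\<^sub>0 int) \<Rightarrow> (('m \<times> 'n) \<Rightarrow>\<^sub>0 int) set" where
  "tensor_coset ra la x = {x + n | n. n \<in> tensor_null ra la}"

record ('h, 'm) left_module =
  lm_carrier :: "'m set"
  lm_zero :: 'm
  lm_add :: "'m \<Rightarrow> 'm \<Rightarrow> 'm"
  lm_act :: "'h \<Rightarrow> 'm \<Rightarrow> 'm"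

text \<open>The left \<open>'h\<close>-module structure on \<open>'h \<otimes>\<^sub>R N\<close>, by multiplication on the first factor.\<close>

definition extension_of_scalars ::
  "('h::ring_1 \<Rightarrow> 'r \<Rightarrow> 'h) \<Rightarrow> ('r \<Rightarrow> 'n::ab_group_add \<Rightarrow> 'n)
    \<Rightarrow> ('h, (('h \<times> 'n) \<Rightarrow>\<^sub>0 int) set) left_module" where
  "extension_of_scalars ra la =
     \<lparr> lm_carrier = range (tensor_coset ra la),
       lm_zero = tensor_coset ra la 0,
       lm_add = (\<lambda>A B. {a + b | a b. a \<in> A \<and> b \<in> B}),
       lm_act = (\<lambda>h A. \<Union>x\<in>A. tensor_coset ra la
                          (frag_extend (\<lambda>(m, n). frag_of (h * m, n)) x)) \<rparr>"

definition submodule :: "('h, 'm) left_module \<Rightarrow> 'm set \<Rightarrow> bool" where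
  "submodule M N \<longleftrightarrow> N \<subseteq> lm_carrier M \<and> lm_zero M \<in> N \<and>
     (\<forall>x\<in>N. \<forall>y\<in>N. lm_add M x y \<in> N) \<and> (\<forall>h. \<forall>x\<in>N. lm_act M h x \<in> N)"

definition irreducible_module :: "('h, 'm) left_module \<Rightarrow> bool" where
  "irreducible_module M \<longleftrightarrow> lm_carrier M \<noteq> {lm_zero M} \<and>
     (\<forall>N. submodule M N \<longrightarrow> N = {lm_zero M} \<or> N = lm_carrier M)"

section \<open>Principal series modules and the set \<open>\<U>\<close>\<close>

definition torus :: "('y::ab_group_add \<Rightarrow> 'f::field) set" where
  "torus = {\<tau>. (\<forall>\<mu>. \<tau> \<mu> \<noteq> 0) \<and> (\<forall>\<mu> \<nu>. \<tau> (\<mu> + \<nu>) = \<tau> \<mu> * \<tau> \<nu>)}"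

definition torus_act :: "('y \<Rightarrow> 'y) \<Rightarrow> ('y \<Rightarrow> 'f) \<Rightarrow> 'y \<Rightarrow> 'f" where
  "torus_act w \<tau> \<mu> = \<tau> (inv w \<mu>)"

definition ga_eval :: "('y \<Rightarrow> 'f) \<Rightarrow> ('y, 'f::comm_ring_1) group_algebra \<Rightarrow> 'f" where
  "ga_eval \<tau> p = (\<Sum>\<mu>\<in>ga_supp p. ga_coeff p \<mu> * \<tau> \<mu>)"

definition principal_series ::
  "('f \<Rightarrow> 'h \<Rightarrow> 'h) \<Rightarrow> ('y \<Rightarrow> ('y \<Rightarrow> 'y) \<Rightarrow> 'h) \<Rightarrow> ('y \<Rightarrow> 'f)
    \<Rightarrow> ('h::ring_1, (('h \<times> 'f::field) \<Rightarrow>\<^sub>0 int) set) left_module" where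
  "principal_series scale ZH \<tau> =
     extension_of_scalars (\<lambda>h p. h * ga_embed scale ZH p) (\<lambda>p c. ga_eval \<tau> p * c)"

definition zeta_simple ::
  "('i, 'x, 'y::fg_free_abelian) root_data \<Rightarrow> ('i \<Rightarrow> 'f::field) \<Rightarrow> ('i \<Rightarrow> 'f) \<Rightarrow> 'i
    \<Rightarrow> ('y, 'f) group_algebra fract" where
  "zeta_simple S \<sigma> \<sigma>' i =
     - to_fract (ga_const (\<sigma> i)) * Q_fract S \<sigma> \<sigma>' i + to_fract (ga_const ((\<sigma> i)\<^sup>2))"

text \<open>\<open>is_zeta S \<sigma> \<sigma>' a z\<close> states \<open>z = \<zeta>\<^sub>a\<close>. It is a relation only because the presentation
  \<open>a = w (simple_coroot S i)\<close> of a coroot is not unique; \<open>z\<close> does not depend on it.\<close>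

definition is_zeta ::
  "('i, 'x, 'y::fg_free_abelian) root_data \<Rightarrow> ('i \<Rightarrow> 'f::field) \<Rightarrow> ('i \<Rightarrow> 'f) \<Rightarrow> 'y
    \<Rightarrow> ('y, 'f) group_algebra fract \<Rightarrow> bool" where
  "is_zeta S \<sigma> \<sigma>' a z \<longleftrightarrow>
     (\<exists>w\<in>weyl S. \<exists>i\<in>index S. a = w (simple_coroot S i) \<and> z = fract_act w (zeta_simple S \<sigma> \<sigma>' i))"

text \<open>Numerators of reduced fractions are unique up to units \<open>c Z\<^sup>\<mu>\<close>, on which points of the
  torus do not vanish, so quantifying over all of them amounts to choosing one.\<close>

definition \<U> ::
  "('i, 'x, 'y::fg_free_abelian) root_data \<Rightarrow> ('i \<Rightarrow> 'f::field) \<Rightarrow> ('i \<Rightarrow> 'f)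
    \<Rightarrow> ('y \<Rightarrow> 'f) set" where
  "\<U> S \<sigma> \<sigma>' = {\<tau> \<in> torus. \<forall>a\<in>coroots S. \<forall>z num den.
     is_zeta S \<sigma> \<sigma>' a z \<and> coprime num den \<and> den \<noteq> 0 \<and> z = Fract num den \<longrightarrow>
     ga_eval \<tau> num \<noteq> 0}"

end

theory Submission
  imports Defs "Jordan_Normal_Form.Determinant"
begin

text \<open>
  The map \<open>h \<otimes> c \<mapsto> c h\<close> identifies \<open>I\<^sub>\<tau>\<close> with the quotient of the algebra by the left ideal
  \<open>J \<tau>\<close> generated by the elements \<open>Z\<^sup>\<mu> - \<tau> \<mu>\<close>, so irreducibility means that \<open>J \<tau>\<close> is maximal.
  If \<open>v\<close> has regular weight \<open>\<chi>\<close>, then \<open>(H\<^sub>s - Q\<^sub>s(\<chi>)) v\<close> has weight \<open>s.\<chi>\<close>; applying these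
  intertwiners along reduced words gives for each \<open>w\<close> a vector \<open>v\<^sub>w\<close> of weight \<open>w.\<tau>\<close> with leading term
  \<open>H\<^sub>w\<close>, hence a basis of \<open>I\<^sub>\<tau>\<close> whose weights are distinct. Two opposite intertwiners compose to
  the scalar \<open>(\<sigma>\<^sub>s - Q\<^sub>s(\<chi>)) (\<sigma>\<^sub>s - Q\<^sub>s(s.\<chi>))\<close>, whose zeros are those of \<open>\<zeta>\<^sub>s(\<chi>) \<zeta>\<^sub>s(s.\<chi>)\<close>. If it
  never vanishes, each \<open>v\<^sub>w\<close> generates \<open>I\<^sub>\<tau>\<close>, while every nonzero submodule contains some \<open>v\<^sub>w\<close>.
  If it vanishes, some \<open>v\<^sub>s\<^sub>w\<close> generates a submodule in which the weight of \<open>v\<^sub>w\<close> does not occur.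
\<close>

text \<open>\<open>W\<close> may be infinite, so no dimension count is available: independence and
  spanning come from triangularity with respect to length, and weight vectors are separated inside
  finite sums. The given basis has \<open>Z\<close> on the left, but the quotient by
  \<open>J \<tau>\<close> calls for the elements \<open>H w * Z \<mu>\<close>; passing to them,
  again by triangularity, shows that no vector with leading term \<open>H w\<close> dies in the
  quotient. In the reducible case both v and its image y under the intertwiner must survive in the
  quotient. The vanishing scalar is symmetric in \<chi> and its reflection, so it can be read at a
  pair w, s w with s w the longer one, where leading terms settle this. The weight of v is then lost
  because \<open>H s * y\<close> is a multiple of y: in the triangular family built on y, the member
  of that weight may be replaced by 0. The values of \<open>Q\<close> need care, since its
  denominator can vanish. Regularity excludes the value 1 for the coroot, and the value -1 forces
  equal parameters, in which case the pole is removable.\<close>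

unbundle no m_inv_syntax

section \<open>Integer multiples in an abelian group\<close>

lemma zsmult_1 [simp]: "zsmult 1 y = y"
  by (simp add: zsmult_def)

lemma zsmult_add_right:
  fixes x y :: "'a::ab_group_add"
  shows "zsmult k (x + y) = zsmult k x + zsmult k y"
  by (simp add: zsmult_def sum.distrib algebra_simps)

lemma zsmult_minus_left:
  fixes y :: "'a::ab_group_add"
  shows "zsmult (- k) y = - zsmult k y"
  by (simp add: zsmult_def)

lemma zsmult_mult:
  fixes y :: "'a::ab_group_add"
  shows "zsmult k (zsmult l y) = zsmult (k * l) y"
proof -
  have pos: "zsmult (int n) (zsmult l y) = zsmult (int n * l) y" for n
    by (induction n) (simp_all add: zsmult_add_left algebra_simps)
  show ?thesis
  proof (cases k rule: int_cases2)
    case (nonpos n)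
    then show ?thesis using pos[of n] by (simp add: zsmult_minus_left)
  qed (use pos in simp)
qed

interpretation zsmult: Modules.module zsmult
  by standard (simp_all add: zsmult_add_left zsmult_add_right zsmult_mult)

lemma int_free_family_eqD:
  fixes v :: "'i \<Rightarrow> 'a::ab_group_add"
  assumes "int_free_family I v" and "(\<Sum>i\<in>I. zsmult (c i) (v i)) = (\<Sum>i\<in>I. zsmult (d i) (v i))"
    and "i \<in> I"
  shows "c i = d i"
proof -
  have "(\<Sum>i\<in>I. zsmult (c i - d i) (v i)) = 0"
    using assms(2) by (simp add: zsmult.scale_left_diff_distrib sum_subtractf)
  then show ?thesis using assms(1,3) by (fastforce simp: int_free_family_def)
qed

lemma additive_zsmult:
  assumes "Modules.additive f"
  shows "f (zsmult k y) = k * f y"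
proof -
  interpret f: Modules.additive f by fact
  show ?thesis by (simp add: zsmult_def f.diff f.sum)
qed

section \<open>The Weyl group as a group of automorphisms of the lattice\<close>

locale root_system =
  fixes S :: "('i, 'x::fg_free_abelian, 'y::fg_free_abelian) root_data"
  assumes root_generating_system: "root_generating_system S"
begin

abbreviation "I \<equiv> index S"
abbreviation "W \<equiv> weyl S"
abbreviation "srefl \<equiv> simple_refl S"
abbreviation "sroot i \<equiv> pairing S (simple_root S i)"
abbreviation "scoroot \<equiv> simple_coroot S"

lemma additive_pairing: "Modules.additive (pairing S x)"
  using root_generating_system
  by (auto simp: root_generating_system_def perfect_pairing_def bij_betw_def)

lemma root_add: "sroot i (x + y) = sroot i x + sroot i y"
  using additive_pairing by (rule additive.add)

lemma root_zsmult: "sroot i (zsmult k y) = k * sroot i y"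
  using additive_pairing by (rule additive_zsmult)

lemma root_diff: "sroot i (x - y) = sroot i x - sroot i y"
  using additive_pairing by (rule additive.diff)

lemma sroot_scoroot [simp]: "i \<in> I \<Longrightarrow> sroot i (scoroot i) = 2"
  using root_generating_system
  by (simp add: root_generating_system_def kac_moody_matrix_def)

lemma finite_I: "finite I"
  using root_generating_system
  by (simp add: root_generating_system_def kac_moody_matrix_def)

lemma refl_add: "srefl i (x + y) = srefl i x + srefl i y"
  by (simp add: simple_refl_def root_add zsmult_add_left algebra_simps)

lemma refl_refl [simp]: "i \<in> I \<Longrightarrow> srefl i (srefl i v) = v"
  by (simp add: simple_refl_def root_diff root_zsmult zsmult.scale_left_diff_distrib
      zsmult_minus_left mult.commute flip: zsmult_mult)

lemma refl_coroot: "i \<in> I \<Longrightarrow> srefl i (scoroot i) = - scoroot i"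
  using zsmult_add_left[of 1 1 "scoroot i"] by (simp add: simple_refl_def)

lemma refl_word_simps [simp]:
  "refl_word S [] = id" "refl_word S (i # is) = srefl i \<circ> refl_word S is"
  by (simp_all add: refl_word_def)

lemma id_in_W [simp]: "id \<in> W"
  unfolding weyl_def by (rule image_eqI[of _ _ "[]"]) simp_all

lemma refl_comp_in_W [simp]: "i \<in> I \<Longrightarrow> w \<in> W \<Longrightarrow> srefl i \<circ> w \<in> W"
proof -
  assume i: "i \<in> I" and "w \<in> W"
  then obtain "is" where "is \<in> lists I" "w = refl_word S is" by (auto simp: weyl_def)
  with i show ?thesis
    unfolding weyl_def by (intro image_eqI[of _ _ "i # is"]) simp_all
qed

lemma refl_in_W [simp]: "i \<in> I \<Longrightarrow> srefl i \<in> W"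
  using refl_comp_in_W[of i id] by simp

lemma W_induct [consumes 1, case_names id step]:
  assumes "w \<in> W" and "P id"
    and "\<And>i w. i \<in> I \<Longrightarrow> w \<in> W \<Longrightarrow> P w \<Longrightarrow> P (srefl i \<circ> w)"
  shows "P w"
proof -
  obtain "is" where is_: "is \<in> lists I" and w: "w = refl_word S is"
    using assms(1) by (auto simp: weyl_def)
  from is_ have "P (refl_word S is)"
  proof (induction rule: lists.induct)
    case Nil
    show ?case using assms(2) by (simp only: refl_word_simps)
  next
    case (Cons i "is")
    then show ?case
      using assms(3)[of i "refl_word S is"] by (simp only: refl_word_simps weyl_def) blast
  qed
  with w show ?thesis by simp
qed

lemma W_add: "w \<in> W \<Longrightarrow> w (x + y) = w x + w y"
  by (induction arbitrary: x y rule: W_induct) (simp_all add: refl_add)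

lemma W_comp: "u \<in> W \<Longrightarrow> w \<in> W \<Longrightarrow> u \<circ> w \<in> W"
  by (induction rule: W_induct) (simp_all add: comp_assoc)

lemma W_inverse:
  assumes "w \<in> W"
  shows "bij w" and "inv w \<in> W"
proof -
  have "\<exists>u\<in>W. u \<circ> w = id \<and> w \<circ> u = id"
    using assms
  proof (induction rule: W_induct)
    case id
    show ?case by (intro bexI[of _ id]) simp_all
  next
    case (step i w)
    then obtain u where u: "u \<in> W" "u \<circ> w = id" "w \<circ> u = id" by blast
    show ?case
      using step(1) u W_comp[OF u(1) refl_in_W[OF step(1)]]
      by (intro bexI[of _ "u \<circ> srefl i"]) (auto simp: fun_eq_iff)
  qed
  then obtain u where u: "u \<in> W" "u \<circ> w = id" "w \<circ> u = id" by blast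
  show "bij w" using u(2,3) by (rule o_bij)
  show "inv w \<in> W" using u inv_unique_comp by metis
qed

lemma inv_refl [simp]: "i \<in> I \<Longrightarrow> inv (srefl i) = srefl i"
  by (rule inv_unique_comp) (auto simp: fun_eq_iff)

lemma W_zero: "w \<in> W \<Longrightarrow> w 0 = 0"
  using W_add[of w 0 0] by simp

lemma W_minus: "w \<in> W \<Longrightarrow> w (- x) = - w x"
  using W_add[of w x "- x"] W_zero[of w] by (simp add: add_eq_0_iff)

lemma W_sum: "w \<in> W \<Longrightarrow> w (\<Sum>i\<in>A. f i) = (\<Sum>i\<in>A. w (f i))"
  by (induction A rule: infinite_finite_induct) (simp_all add: W_zero W_add)

lemma W_zsmult: "w \<in> W \<Longrightarrow> w (zsmult k y) = zsmult k (w y)"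
  \<comment> \<open>Additivity at (x - y) + y, where x - y is the difference that defines
    \<open>zsmult\<close>, gives the rule for differences.\<close>
  using W_add[of w "(\<Sum>i<nat k. y) - (\<Sum>i<nat (- k). y)" "\<Sum>i<nat (- k). y"]
  by (simp add: zsmult_def W_sum algebra_simps)

subsection \<open>Length and sign\<close>

lemma len_refl_word_le: "is \<in> lists I \<Longrightarrow> len S (refl_word S is) \<le> length is"
  unfolding len_def by (rule Least_le) blast

lemma ex_reduced_word:
  assumes "w \<in> W"
  obtains "is" where "is \<in> lists I" "length is = len S w" "refl_word S is = w"
proof -
  have "\<exists>n. \<exists>is\<in>lists I. length is = n \<and> refl_word S is = w"
    using assms by (auto simp: weyl_def)
  from LeastI_ex[OF this] show thesis using that unfolding len_def by blast
qed

lemma len_id [simp]: "len S id = 0"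
  using len_refl_word_le[of "[]"] by simp

lemma len_refl_comp_le:
  assumes "i \<in> I" and "w \<in> W"
  shows "len S (srefl i \<circ> w) \<le> len S w + 1"
proof -
  obtain "is" where "is \<in> lists I" "length is = len S w" "refl_word S is = w"
    using ex_reduced_word[OF assms(2)] .
  then show ?thesis using len_refl_word_le[of "i # is"] assms(1) by simp
qed

lemma refl_refl_comp [simp]: "i \<in> I \<Longrightarrow> srefl i \<circ> (srefl i \<circ> w) = w"
  by (simp add: fun_eq_iff)

text \<open>Removing the first letter of a reduced word lowers the length by at least one, the
  remaining word being shorter, and by at most one, by \<open>len_refl_comp_le\<close>. This drives
  the inductions on length below.\<close>

lemma W_cases_len:
  assumes "w \<in> W" and "w \<noteq> id"
  obtains i u where "i \<in> I" "u \<in> W" "w = srefl i \<circ> u" "len S w = len S u + 1"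
proof -
  obtain "is" where is_: "is \<in> lists I" "length is = len S w" "refl_word S is = w"
    using ex_reduced_word[OF assms(1)] .
  with assms(2) obtain i js where js: "is = i # js" by (cases "is") auto
  define u where "u = refl_word S js"
  have "i \<in> I" "u \<in> W" "w = srefl i \<circ> u" using is_ js by (auto simp: u_def weyl_def)
  moreover have "len S u \<le> length js" unfolding u_def by (rule len_refl_word_le) (use is_ js in auto)
  moreover have "len S w \<le> len S u + 1" using calculation len_refl_comp_le by simp
  ultimately show thesis using that is_ js by fastforce
qed

text \<open>The sign of \<open>w\<close> is the determinant of its action on the coroot lattice.\<close>

lemma even_length_cong:
  assumes "is \<in> lists I" and "js \<in> lists I" and "refl_word S is = refl_word S js"
  shows "even (length is) \<longleftrightarrow> even (length js)"
proof -
  define n where "n = card I"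
  obtain e where e: "bij_betw e {0..<n} I"
    using ex_bij_betw_nat_finite[OF finite_I] unfolding n_def by blast
  have e_I: "e k \<in> I" if "k < n" for k using e that by (auto simp: bij_betw_def)
  have e_eq: "e k = e l \<longleftrightarrow> k = l" if "k < n" "l < n" for k l
    using e that by (auto simp: bij_betw_def inj_on_def)
  define M where "M i = mat n n (\<lambda>(l, k). (if l = k then 1 else 0)
                          - (if e l = i then sroot i (scoroot (e k)) else 0))" for i
  have M_carrier: "M i \<in> carrier_mat n n" for i by (simp add: M_def)
  \<comment> \<open>\<open>M i\<close> is the matrix of the reflection on the simple coroots and
    differs from the identity only in the row of i. Hence only the identity permutation contributes
    to the determinant, and the diagonal entry of that row is 1 - 2.\<close>
  have det_M: "det (M i) = -1" if i: "i \<in> I" for i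
  proof -
    let ?t = "\<lambda>p. signof p * (\<Prod>l = 0..<n. M i $$ (l, p l))"
    obtain m where m: "m < n" "e m = i"
      using e i by (metis bij_betwE bij_betw_inv_into bij_betw_inv_into_right atLeastLessThan_iff)
    have "?t p = 0" if p: "p permutes {0..<n}" "p \<noteq> id" for p
    proof -
      obtain l where l: "p l \<noteq> l" using p(2) by (auto simp: fun_eq_iff)
      have pn: "p k < n \<longleftrightarrow> k < n" for k using permutes_in_image[OF p(1), of k] by simp
      have ln: "l < n" using l permutes_not_in[OF p(1), of l] by auto
      have pl: "p (p l) \<noteq> p l" using l permutes_inj[OF p(1)] by (auto dest: injD)
      \<comment> \<open>p moves both l and p l, and at most one of them indexes the row of i; k is
        one that does not.\<close>
      define k where "k = (if e l = i then p l else l)"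
      have k: "k < n" "p k < n" "p k \<noteq> k" using ln l pl pn by (auto simp: k_def)
      have "e k \<noteq> i" using ln l pn e_eq[of "p l" l] by (auto simp: k_def)
      with k have "M i $$ (k, p k) = 0" by (simp add: M_def)
      then have "(\<Prod>l = 0..<n. M i $$ (l, p l)) = 0" using k(1) by (intro prod_zero) auto
      then show ?thesis by simp
    qed
    then have "det (M i) = (\<Sum>p\<in>{id}. ?t p)"
      unfolding det_def'[OF M_carrier]
      by (intro sum.mono_neutral_right) (auto simp: finite_permutations permutes_id)
    also have "\<dots> = (\<Prod>l = 0..<n. M i $$ (l, l))" by (simp add: sign_id)
    also have "\<dots> = (\<Prod>l = 0..<n. if l = m then -1 else 1)"
    proof (rule prod.cong[OF refl])
      fix l assume "l \<in> {0..<n}"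
      then show "M i $$ (l, l) = (if l = m then -1 else 1)"
        using m i e_eq[of l m] sroot_scoroot[OF i] by (cases "l = m") (auto simp: M_def)
    qed
    also have "\<dots> = -1" using m by simp
    finally show ?thesis .
  qed
  have M_refl: "srefl i (scoroot (e k)) = (\<Sum>l = 0..<n. zsmult (M i $$ (l, k)) (scoroot (e l)))"
    if i: "i \<in> I" and k: "k < n" for i k
  proof -
    obtain m where m: "m < n" "e m = i"
      using e i by (metis bij_betwE bij_betw_inv_into bij_betw_inv_into_right atLeastLessThan_iff)
    have "(\<Sum>l = 0..<n. zsmult (M i $$ (l, k)) (scoroot (e l)))
      = (\<Sum>l = 0..<n. (if l = k then scoroot (e k) else 0)
           - (if l = m then zsmult (sroot i (scoroot (e k))) (scoroot i) else 0))"
      using k m e_eq by (intro sum.cong)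
        (auto simp: M_def zsmult.scale_left_diff_distrib zsmult_minus_left)
    also have "\<dots> = srefl i (scoroot (e k))"
      using k m by (simp add: sum_subtractf simple_refl_def)
    finally show ?thesis by simp
  qed
  have word: "\<exists>N\<in>carrier_mat n n. det N = (-1) ^ length is \<and>
      (\<forall>k<n. refl_word S is (scoroot (e k)) = (\<Sum>l = 0..<n. zsmult (N $$ (l, k)) (scoroot (e l))))"
    if "is \<in> lists I" for "is"
    using that
  proof (induction rule: lists.induct)
    case Nil
    have "scoroot (e k) = (\<Sum>l = 0..<n. zsmult (1\<^sub>m n $$ (l, k)) (scoroot (e l)))" if "k < n" for k
    proof -
      have "(\<Sum>l = 0..<n. zsmult (1\<^sub>m n $$ (l, k)) (scoroot (e l)))
        = (\<Sum>l = 0..<n. if l = k then scoroot (e k) else 0)"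
        using that by (intro sum.cong) auto
      then show ?thesis using that by simp
    qed
    then show ?case by (intro bexI[of _ "1\<^sub>m n"]) auto
  next
    case (Cons i "is")
    then obtain N where N: "N \<in> carrier_mat n n" "det N = (-1) ^ length is"
      "\<And>k. k < n \<Longrightarrow>
        refl_word S is (scoroot (e k)) = (\<Sum>l = 0..<n. zsmult (N $$ (l, k)) (scoroot (e l)))"
      by blast
    have "refl_word S (i # is) (scoroot (e k))
        = (\<Sum>l = 0..<n. zsmult ((M i * N) $$ (l, k)) (scoroot (e l)))" if k: "k < n" for k
    proof -
      have "refl_word S (i # is) (scoroot (e k))
          = (\<Sum>l = 0..<n. zsmult (N $$ (l, k)) (srefl i (scoroot (e l))))"
        using N(3)[OF k] Cons(1) by (simp add: W_sum[OF refl_in_W] W_zsmult[OF refl_in_W])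
      also have "\<dots> = (\<Sum>l = 0..<n. \<Sum>l' = 0..<n.
                        zsmult (M i $$ (l', l) * N $$ (l, k)) (scoroot (e l')))"
        using Cons(1) by (intro sum.cong)
          (simp_all add: M_refl zsmult.scale_sum_right zsmult_mult mult.commute)
      also have "\<dots> = (\<Sum>l' = 0..<n. zsmult (\<Sum>l = 0..<n. M i $$ (l', l) * N $$ (l, k)) (scoroot (e l')))"
        by (subst sum.swap) (simp add: zsmult.scale_sum_left)
      also have "\<dots> = (\<Sum>l = 0..<n. zsmult ((M i * N) $$ (l, k)) (scoroot (e l)))"
        using k N(1) M_carrier[of i] by (intro sum.cong) (auto simp: scalar_prod_def)
      finally show ?thesis .
    qed
    moreover have "det (M i * N) = (-1) ^ length (i # is)"
      using det_mult[OF M_carrier N(1)] det_M[OF Cons(1)] N(2) by simp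
    ultimately show ?case
      using mult_carrier_mat[OF M_carrier N(1)] by (intro bexI[of _ "M i * N"]) auto
  qed
  have free: "int_free_family {0..<n} (\<lambda>l. scoroot (e l))"
    unfolding int_free_family_def
  proof (intro allI impI ballI)
    fix c l assume c: "(\<Sum>l\<in>{0..<n}. zsmult (c l) (scoroot (e l))) = 0" and l: "l \<in> {0..<n}"
    have "(\<Sum>l = 0..<n. zsmult (c (inv_into {0..<n} e (e l))) (scoroot (e l)))
        = (\<Sum>l = 0..<n. zsmult (c l) (scoroot (e l)))"
      using e by (intro sum.cong) (auto simp: bij_betw_def)
    with c have "(\<Sum>i\<in>I. zsmult (c (inv_into {0..<n} e i)) (scoroot i)) = 0"
      unfolding sum.reindex_bij_betw[OF e, symmetric] by simp
    moreover have "int_free_family I scoroot"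
      using root_generating_system by (simp add: root_generating_system_def)
    ultimately have "c (inv_into {0..<n} e (e l)) = 0"
      using e_I l by (force simp: int_free_family_def dest!: spec[of _ "\<lambda>i. c (inv_into {0..<n} e i)"])
    then show "c l = 0" using e l by (simp add: bij_betw_def)
  qed
  obtain N where N: "N \<in> carrier_mat n n" "det N = (-1) ^ length is"
    "\<And>k. k < n \<Longrightarrow>
        refl_word S is (scoroot (e k)) = (\<Sum>l = 0..<n. zsmult (N $$ (l, k)) (scoroot (e l)))"
    using word[OF assms(1)] by blast
  obtain N' where N': "N' \<in> carrier_mat n n" "det N' = (-1) ^ length js"
    "\<And>k. k < n \<Longrightarrow>
        refl_word S js (scoroot (e k)) = (\<Sum>l = 0..<n. zsmult (N' $$ (l, k)) (scoroot (e l)))"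
    using word[OF assms(2)] by blast
  \<comment> \<open>Freeness of the coroots makes the matrix depend on the group element alone, not
    on the word.\<close>
  have "N $$ (l, k) = N' $$ (l, k)" if "l < n" "k < n" for l k
    using int_free_family_eqD[OF free, of "\<lambda>l. N $$ (l, k)" "\<lambda>l. N' $$ (l, k)" l]
      N(3)[OF that(2)] N'(3)[OF that(2)] assms(3) that(1) by simp
  then have "N = N'" using N(1) N'(1) by (intro eq_matI) auto
  with N(2) N'(2) have "(-1) ^ length is = ((-1) ^ length js :: int)" by simp
  then show ?thesis by (metis neg_one_even_power neg_one_odd_power one_neq_neg_one)
qed

text \<open>Parity excludes equal lengths. The two multiplication rules in
  \<open>BL_hecke_algebra\<close>, stated for length differences of exactly one, therefore cover all
  cases.\<close>

lemma len_refl_comp_cases: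
  assumes "i \<in> I" and "w \<in> W"
  shows "len S (srefl i \<circ> w) = len S w + 1 \<or> len S w = len S (srefl i \<circ> w) + 1"
proof -
  obtain "is" where is_: "is \<in> lists I" "length is = len S w" "refl_word S is = w"
    using ex_reduced_word[OF assms(2)] .
  obtain js where js: "js \<in> lists I" "length js = len S (srefl i \<circ> w)" "refl_word S js = srefl i \<circ> w"
    using ex_reduced_word[OF refl_comp_in_W[OF assms]] .
  have "even (length (i # is)) \<longleftrightarrow> even (length js)"
    by (rule even_length_cong) (use is_ js assms in auto)
  then have "len S (srefl i \<circ> w) \<noteq> len S w" using is_ js by auto
  moreover have "len S (srefl i \<circ> w) \<le> len S w + 1" using len_refl_comp_le assms by blast
  moreover have "len S w \<le> len S (srefl i \<circ> w) + 1"
    using len_refl_comp_le[OF assms(1) refl_comp_in_W[OF assms]] assms(1) by simp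
  ultimately show ?thesis by linarith
qed

lemma len_refl [simp]: "i \<in> I \<Longrightarrow> len S (srefl i) = 1"
  using len_refl_comp_cases[of i id] by simp

end

section \<open>Homomorphisms of group algebras\<close>

lemma ga_coeff_simps [simp]:
  "ga_coeff (p + q) \<mu> = ga_coeff p \<mu> + ga_coeff q \<mu>"
  "ga_coeff (p - q) \<mu> = ga_coeff p \<mu> - ga_coeff q \<mu>"
  "ga_coeff (- p) \<mu> = - ga_coeff p \<mu>"
  "ga_coeff 0 \<mu> = 0"
  unfolding ga_coeff_def by (transfer, simp add: lookup_add lookup_minus)+

lemma ga_supp_eq: "ga_supp p = {\<mu>. ga_coeff p \<mu> \<noteq> 0}"
  by (auto simp: ga_supp_def ga_coeff_def in_keys_iff)

lemma finite_ga_supp [simp]: "finite (ga_supp p)"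
  by (simp add: ga_supp_def)

lemma ga_coeff_monom:
  fixes \<mu> :: "'y::comm_monoid_add" and c :: "'f::comm_ring_1"
  shows "ga_coeff (ga_const c * ga_Z \<mu>) \<nu> = (if \<nu> = \<mu> then c else 0)"
  unfolding ga_coeff_def by transfer (simp add: mult_single lookup_single when_def)

lemma ga_coeff_const: "ga_coeff (ga_const c) \<nu> = (if \<nu> = 0 then c else 0)"
  unfolding ga_coeff_def by transfer (simp add: lookup_single when_def)

lemma ga_coeff_Z: "ga_coeff (ga_Z \<mu>) \<nu> = (if \<nu> = \<mu> then 1 else 0)"
  unfolding ga_coeff_def by transfer (simp add: lookup_single when_def)

lemma ga_eqI: "(\<And>\<mu>. ga_coeff p \<mu> = ga_coeff q \<mu>) \<Longrightarrow> p = q"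
  unfolding ga_coeff_def by transfer (rule poly_mapping_eqI)

lemma ga_coeff_sum: "ga_coeff (\<Sum>i\<in>A. f i) \<mu> = (\<Sum>i\<in>A. ga_coeff (f i) \<mu>)"
  by (induction A rule: infinite_finite_induct) simp_all

lemma ga_const_simps [simp]:
  "ga_const (c + d) = ga_const c + ga_const d"
  "ga_const (c - d) = ga_const c - ga_const d"
  "ga_const (- c) = - ga_const c"
  "ga_const 0 = 0"
  "ga_const 1 = 1"
  by (transfer, simp add: single_add single_diff single_uminus)+

lemma ga_const_mult [simp]: "ga_const (c * d) = ga_const c * ga_const d"
  by transfer (simp add: mult_single)

lemma ga_Z_zero [simp]: "ga_Z 0 = 1"
  by transfer simp

lemma ga_Z_add: "ga_Z (\<mu> + \<nu>) = ga_Z \<mu> * ga_Z \<nu>"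
  by transfer (simp add: mult_single)

lemma ga_expansion:
  fixes p :: "('y::comm_monoid_add, 'f::comm_ring_1) group_algebra"
  shows "p = (\<Sum>\<mu>\<in>ga_supp p. ga_const (ga_coeff p \<mu>) * ga_Z \<mu>)"
proof (rule ga_eqI)
  fix \<nu>
  have "ga_coeff (\<Sum>\<mu>\<in>ga_supp p. ga_const (ga_coeff p \<mu>) * ga_Z \<mu>) \<nu>
      = (if \<nu> \<in> ga_supp p then ga_coeff p \<nu> else 0)"
    by (simp add: ga_coeff_sum ga_coeff_monom)
  then show "ga_coeff p \<nu> = ga_coeff (\<Sum>\<mu>\<in>ga_supp p. ga_const (ga_coeff p \<mu>) * ga_Z \<mu>) \<nu>"
    by (simp add: ga_supp_eq)
qed

lemma ga_induct [case_names monom add]: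
  fixes p :: "('y::comm_monoid_add, 'f::comm_ring_1) group_algebra"
  assumes monom: "\<And>c \<mu>. P (ga_const c * ga_Z \<mu>)" and add: "\<And>p q. P p \<Longrightarrow> P q \<Longrightarrow> P (p + q)"
  shows "P p"
proof -
  have "P (\<Sum>\<mu>\<in>A. ga_const (ga_coeff p \<mu>) * ga_Z \<mu>)" if "finite A" for A
    using that
  proof (induction A rule: finite_induct)
    case empty
    show ?case using monom[of 0 0] by simp
  qed (simp add: monom add)
  then show ?thesis using ga_expansion[of p] finite_ga_supp by metis
qed

text \<open>Shared by \<open>ga_eval\<close> and \<open>ga_act\<close>, both of which are sums over
  the support of a term additive in the coefficient. Cancellation may shrink the support of p + q,
  so all three sums are extended to the union of the supports of p and q.\<close>

lemma ga_sum_add: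
  fixes F :: "'f::comm_ring_1 \<Rightarrow> 'y::comm_monoid_add \<Rightarrow> 'b::comm_monoid_add"
  assumes F: "\<And>c d \<mu>. F (c + d) \<mu> = F c \<mu> + F d \<mu>" "\<And>\<mu>. F 0 \<mu> = 0"
  shows "(\<Sum>\<mu>\<in>ga_supp (p + q). F (ga_coeff (p + q) \<mu>) \<mu>)
    = (\<Sum>\<mu>\<in>ga_supp p. F (ga_coeff p \<mu>) \<mu>) + (\<Sum>\<mu>\<in>ga_supp q. F (ga_coeff q \<mu>) \<mu>)"
proof -
  let ?A = "ga_supp p \<union> ga_supp q"
  have sup: "(\<Sum>\<mu>\<in>ga_supp r. F (ga_coeff r \<mu>) \<mu>) = (\<Sum>\<mu>\<in>?A. F (ga_coeff r \<mu>) \<mu>)"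
    if "ga_supp r \<subseteq> ?A" for r
  proof (rule sum.mono_neutral_left)
    show "\<forall>\<mu>\<in>?A - ga_supp r. F (ga_coeff r \<mu>) \<mu> = 0" by (auto simp: F ga_supp_eq)
  qed (use that in simp_all)
  have "ga_supp (p + q) \<subseteq> ?A" by (auto simp: ga_supp_eq)
  then show ?thesis using sup[of p] sup[of q] sup[of "p + q"] by (simp add: F sum.distrib)
qed

lemma ga_sum_monom:
  fixes F :: "'f::comm_ring_1 \<Rightarrow> 'y::comm_monoid_add \<Rightarrow> 'b::comm_monoid_add"
  assumes "\<And>\<mu>. F 0 \<mu> = 0"
  shows "(\<Sum>\<nu>\<in>ga_supp (ga_const c * ga_Z \<mu>). F (ga_coeff (ga_const c * ga_Z \<mu>) \<nu>) \<nu>) = F c \<mu>"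
proof (cases "c = 0")
  case False
  then have "ga_supp (ga_const c * ga_Z \<mu>) = {\<mu>}" by (auto simp: ga_supp_eq ga_coeff_monom)
  then show ?thesis by (simp add: ga_coeff_monom)
qed (simp add: assms ga_supp_eq)

lemma ga_monom_mult:
  "ga_const c * ga_Z \<mu> * (ga_const d * ga_Z \<nu>) = ga_const (c * d) * ga_Z (\<mu> + \<nu>)"
  by (simp add: ga_Z_add algebra_simps)

lemma ga_hom_mult:
  fixes f :: "('y::comm_monoid_add, 'f::comm_ring_1) group_algebra \<Rightarrow> 'b::comm_ring_1"
  assumes add: "\<And>p q. f (p + q) = f p + f q"
    and monom: "\<And>c d \<mu> \<nu>. f (ga_const (c * d) * ga_Z (\<mu> + \<nu>))
      = f (ga_const c * ga_Z \<mu>) * f (ga_const d * ga_Z \<nu>)"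
  shows "f (p * q) = f p * f q"
proof (induction p rule: ga_induct)
  case (monom c \<mu>)
  show ?case
  proof (induction q rule: ga_induct)
    case (monom d \<nu>)
    show ?case using assms(2)[of c d \<mu> \<nu>] by (simp only: ga_monom_mult)
  qed (simp add: add algebra_simps)
qed (simp add: add algebra_simps)

lemma ga_eval_add: "ga_eval \<tau> (p + q) = ga_eval \<tau> p + ga_eval \<tau> q"
  unfolding ga_eval_def by (rule ga_sum_add) (simp_all add: algebra_simps)

lemma ga_eval_monom: "ga_eval \<tau> (ga_const c * ga_Z \<mu>) = c * \<tau> \<mu>"
  unfolding ga_eval_def by (rule ga_sum_monom) simp

lemma torus_add: "\<tau> \<in> torus \<Longrightarrow> \<tau> (\<mu> + \<nu>) = \<tau> \<mu> * \<tau> \<nu>"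
  by (simp add: torus_def)

lemma torus_nonzero: "\<tau> \<in> torus \<Longrightarrow> \<tau> \<mu> \<noteq> 0"
  by (simp add: torus_def)

lemma torus_zero [simp]: "\<tau> \<in> torus \<Longrightarrow> \<tau> 0 = 1"
  using torus_add[of \<tau> 0 0] torus_nonzero[of \<tau> 0] by simp

lemma torus_minus: "\<tau> \<in> torus \<Longrightarrow> \<tau> (- \<mu>) = inverse (\<tau> \<mu>)"
  using torus_add[of \<tau> \<mu> "- \<mu>"] torus_nonzero[of \<tau> \<mu>] by (simp add: inverse_unique)

lemma torus_zsmult_eq_1:
  assumes "\<tau> \<in> torus" and "\<tau> \<mu> = 1"
  shows "\<tau> (zsmult k \<mu>) = 1"
proof -
  have pos: "\<tau> (zsmult (int n) \<mu>) = 1" for n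
    using assms by (induction n) (simp_all add: zsmult_add_left torus_add)
  show ?thesis
  proof (cases k rule: int_cases2)
    case (nonpos n)
    then show ?thesis using pos[of n] assms(1) by (simp add: zsmult_minus_left torus_minus)
  qed (use pos in simp)
qed

lemma ga_eval_hom:
  assumes "\<tau> \<in> torus"
  shows "ga_eval \<tau> (p * q) = ga_eval \<tau> p * ga_eval \<tau> q"
    and "ga_eval \<tau> (ga_const c) = c" and "ga_eval \<tau> (ga_Z \<mu>) = \<tau> \<mu>"
    and "ga_eval \<tau> 1 = 1" and "ga_eval \<tau> (p - q) = ga_eval \<tau> p - ga_eval \<tau> q"
proof -
  show "ga_eval \<tau> (p * q) = ga_eval \<tau> p * ga_eval \<tau> q"
    by (rule ga_hom_mult)
       (simp_all only: ga_eval_add ga_eval_monom torus_add[OF assms], simp add: ac_simps)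
  show "ga_eval \<tau> (ga_const c) = c"
    using ga_eval_monom[of \<tau> c 0] assms by simp
  show "ga_eval \<tau> (ga_Z \<mu>) = \<tau> \<mu>"
    using ga_eval_monom[of \<tau> 1 \<mu>] by simp
  show "ga_eval \<tau> 1 = 1"
    using ga_eval_monom[of \<tau> 1 0] assms by simp
  show "ga_eval \<tau> (p - q) = ga_eval \<tau> p - ga_eval \<tau> q"
    using ga_eval_add[of \<tau> "p - q" q] by simp
qed

lemma ga_act_add: "ga_act w (p + q) = ga_act w p + ga_act w q"
  unfolding ga_act_def by (rule ga_sum_add) (simp_all add: algebra_simps)

lemma ga_act_monom: "ga_act w (ga_const c * ga_Z \<mu>) = ga_const c * ga_Z (w \<mu>)"
  unfolding ga_act_def by (rule ga_sum_monom) simp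

lemma ga_act_mult:
  assumes "\<And>x y. w (x + y) = w x + w y"
  shows "ga_act w (p * q) = ga_act w p * ga_act w q"
  by (rule ga_hom_mult) (simp_all only: ga_act_add ga_act_monom assms ga_monom_mult)

lemma ga_act_comp: "ga_act u (ga_act w p) = ga_act (u \<circ> w) p"
  by (induction p rule: ga_induct) (simp_all add: ga_act_monom ga_act_add)

lemma ga_act_id: "ga_act id p = p"
  by (induction p rule: ga_induct) (simp_all add: ga_act_monom ga_act_add)

lemma ga_act_zero [simp]: "ga_act w 0 = 0"
  by (simp add: ga_act_def ga_supp_eq)

lemma ga_act_eq_0_iff:
  assumes "bij w"
  shows "ga_act w p = 0 \<longleftrightarrow> p = 0"
proof
  assume "ga_act w p = 0"
  then have "ga_act (inv w) (ga_act w p) = 0" by simp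
  then show "p = 0" using assms by (simp add: ga_act_comp ga_act_id bij_is_inj)
qed simp

lemma ga_eval_act: "ga_eval \<tau> (ga_act w p) = ga_eval (\<tau> \<circ> w) p"
  by (induction p rule: ga_induct) (simp_all add: ga_act_monom ga_act_add ga_eval_add ga_eval_monom)

text \<open>Independence of the representative: equal fractions satisfy a cross-multiplication
  identity, which \<open>ga_act w\<close> preserves, and bijectivity of w keeps denominators
  nonzero.\<close>

lemma fract_act_Fract:
  fixes w :: "'y::fg_free_abelian \<Rightarrow> 'y" and b :: "('y, 'f::idom) group_algebra"
  assumes w: "bij w" "\<And>x y. w (x + y) = w x + w y" and b: "b \<noteq> 0"
  shows "fract_act w (Fract a b) = Fract (ga_act w a) (ga_act w b)"
  unfolding fract_act_def
proof (rule the_equality)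
  show "\<exists>a' b'. b' \<noteq> 0 \<and> Fract a b = Fract a' b' \<and>
      Fract (ga_act w a) (ga_act w b) = Fract (ga_act w a') (ga_act w b')"
    using b by blast
next
  fix r assume "\<exists>a' b'. b' \<noteq> 0 \<and> Fract a b = Fract a' b' \<and> r = Fract (ga_act w a') (ga_act w b')"
  then obtain a' b' where *: "b' \<noteq> 0" "Fract a b = Fract a' b'"
    "r = Fract (ga_act w a') (ga_act w b')" by blast
  then have "a * b' = a' * b" using b by (simp add: eq_fract)
  then have "ga_act w a * ga_act w b' = ga_act w a' * ga_act w b"
    using ga_act_mult[OF w(2)] by metis
  then show "r = Fract (ga_act w a) (ga_act w b)"
    using * b w(1) by (simp add: eq_fract ga_act_eq_0_iff)
qed

section \<open>Comaximal pairs and reduced fractions\<close>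

text \<open>A Bezout relation implies coprimality, is carried along by \<open>ga_act w\<close> for
  additive w, and determines reduced numerators up to a unit.\<close>

definition comaximal :: "'a::comm_ring_1 \<Rightarrow> 'a \<Rightarrow> bool" where
  "comaximal a b \<longleftrightarrow> (\<exists>u v. u * a + v * b = 1)"

lemma comaximal_sym: "comaximal a b \<Longrightarrow> comaximal b a"
  unfolding comaximal_def by (metis add.commute)

text \<open>Multiply the two Bezout relations: every term except the one with a * b contains
  c.\<close>

lemma comaximal_mult:
  assumes "comaximal a c" and "comaximal b c"
  shows "comaximal (a * b) c"
proof -
  obtain u v u' v' where *: "u * a + v * c = 1" "u' * b + v' * c = 1"
    using assms unfolding comaximal_def by blast
  have "(u * u') * (a * b) + (u * a * v' + v * u' * b + v * c * v') * c
      = (u * a + v * c) * (u' * b + v' * c)"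
    by (simp add: algebra_simps)
  then show ?thesis unfolding comaximal_def using * by (metis mult_1)
qed

lemma comaximal_imp_coprime:
  fixes a b :: "'a::{comm_ring_1, algebraic_semidom}"
  assumes "comaximal a b"
  shows "coprime a b"
proof (rule coprimeI)
  fix c assume "c dvd a" "c dvd b"
  then show "is_unit c" using assms unfolding comaximal_def by (metis dvd_add dvd_mult)
qed

text \<open>The Bezout coefficients u, v of n and d, applied to a and b, give c = u a + v b with a =
  c n and b = c d. As a common divisor of a coprime pair, c is a unit.\<close>

lemma coprime_Fract_eq_comaximal:
  fixes a b :: "'a::{idom, algebraic_semidom}"
  assumes "coprime a b" and "b \<noteq> 0" and "comaximal n d" and "d \<noteq> 0" and "Fract a b = Fract n d"
  obtains c where "is_unit c" "a = c * n"
proof -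
  obtain u v where uv: "u * n + v * d = 1" using assms(3) unfolding comaximal_def by blast
  have eq: "a * d = n * b" using assms by (simp add: eq_fract)
  define c where "c = u * a + v * b"
  have "a = c * n"
  proof -
    have "a = a * (u * n + v * d)" by (simp add: uv)
    also have "\<dots> = u * a * n + v * (a * d)" by (simp add: algebra_simps)
    also have "\<dots> = c * n" by (simp add: eq c_def algebra_simps)
    finally show ?thesis .
  qed
  moreover have "b = c * d"
  proof -
    have "b = b * (u * n + v * d)" by (simp add: uv)
    also have "\<dots> = u * (n * b) + v * b * d" by (simp add: algebra_simps)
    also have "\<dots> = u * (a * d) + v * b * d" by (simp only: eq)
    also have "\<dots> = c * d" by (simp add: c_def algebra_simps)
    finally show ?thesis .
  qed
  ultimately have "is_unit c" using assms(1) by (metis coprime_def dvd_triv_left)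
  with \<open>a = c * n\<close> show thesis using that by blast
qed

text \<open>The combination b (1 - a X) - a (1 - b X) = b - a is a nonzero constant.\<close>

lemma comaximal_linear:
  fixes X :: "('y::comm_monoid_add, 'f::field) group_algebra"
  assumes "a \<noteq> b"
  shows "comaximal (1 - ga_const a * X) (1 - ga_const b * X)"
proof -
  let ?i = "inverse (b - a)"
  have "ga_const (?i * b) * (1 - ga_const a * X) + ga_const (- (?i * a)) * (1 - ga_const b * X)
      = ga_const (?i * (b - a))"
    unfolding ga_const_mult ga_const_simps by (simp add: algebra_simps)
  also have "\<dots> = 1" using assms by simp
  finally show ?thesis unfolding comaximal_def by blast
qed

section \<open>The parameters of the Hecke algebra at a point of the torus\<close>

locale hecke_datum = root_system S
  for S :: "('i, 'x::fg_free_abelian, 'y::fg_free_abelian) root_data" +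
  fixes \<sigma> \<sigma>' :: "'i \<Rightarrow> 'f::field_char_0"
  assumes hecke_parameters: "hecke_parameters S \<sigma> \<sigma>'"
    and nondegenerate: "\<forall>i\<in>index S. \<sigma>' i \<notin> {inverse (\<sigma> i), - \<sigma> i, - inverse (\<sigma> i)}"
begin

lemma sigma_nonzero: "i \<in> I \<Longrightarrow> \<sigma> i \<noteq> 0" "i \<in> I \<Longrightarrow> \<sigma>' i \<noteq> 0"
  using hecke_parameters by (auto simp: hecke_parameters_def)

abbreviation "X i \<equiv> (ga_Z (- scoroot i) :: ('y, 'f) group_algebra)"

lemma scoroot_nonzero: "i \<in> I \<Longrightarrow> scoroot i \<noteq> 0"
proof
  assume "i \<in> I" "scoroot i = 0"
  then show False using sroot_scoroot[of i] root_zsmult[of i 0 0] by simp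
qed

lemma X_square: "ga_Z (zsmult (- 2) (scoroot i)) = X i * X i"
  using zsmult_add_left[of "-1" "-1" "scoroot i"]
  by (simp add: zsmult_minus_left flip: ga_Z_add)

lemma one_minus_const_X_nonzero: "i \<in> I \<Longrightarrow> 1 - ga_const c * X i \<noteq> 0"
proof
  assume i: "i \<in> I" and "1 - ga_const c * X i = 0"
  then have "ga_coeff (1 - ga_const c * X i) 0 = 0" by simp
  then show False
    using scoroot_nonzero[OF i] ga_coeff_const[of "1::'f" "0::'y"] by (simp add: ga_coeff_monom)
qed

text \<open>Over the denominator 1 - X^2 the numerator of zeta is (1 - \<sigma> \<sigma>' X) (1 +
  (\<sigma> / \<sigma>') X). For equal parameters 1 + X divides both and is cancelled here.\<close>

definition zeta_num :: "'i \<Rightarrow> ('y, 'f) group_algebra" where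
  "zeta_num i = (if \<sigma> i = \<sigma>' i then 1 - ga_const ((\<sigma> i)\<^sup>2) * X i
     else (1 - ga_const (\<sigma> i * \<sigma>' i) * X i) * (1 - ga_const (- (\<sigma> i / \<sigma>' i)) * X i))"

text \<open>The constants 1 and -1 stay explicit so that each factor has the shape required by
  \<open>comaximal_linear\<close>.\<close>

definition zeta_den :: "'i \<Rightarrow> ('y, 'f) group_algebra" where
  "zeta_den i = (if \<sigma> i = \<sigma>' i then 1 - ga_const 1 * X i
     else (1 - ga_const 1 * X i) * (1 - ga_const (- 1) * X i))"

lemma zeta_den_nonzero: "i \<in> I \<Longrightarrow> zeta_den i \<noteq> 0"
  unfolding zeta_den_def using one_minus_const_X_nonzero by (metis mult_eq_0_iff)

text \<open>This is where \<open>nondegenerate\<close> enters: \<sigma> \<sigma>' differs from 1 and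
  -1, and -\<sigma> / \<sigma>' differs from 1, by the three excluded values of \<sigma>'; it
  differs from -1 because the parameters are unequal in that case.\<close>

lemma comaximal_zeta: "i \<in> I \<Longrightarrow> comaximal (zeta_num i) (zeta_den i)"
proof -
  assume i: "i \<in> I"
  note nz = sigma_nonzero[OF i] and nd = bspec[OF nondegenerate i]
  show ?thesis
  proof (cases "\<sigma> i = \<sigma>' i")
    case True
    have "(\<sigma> i)\<^sup>2 \<noteq> 1"
    proof
      assume "(\<sigma> i)\<^sup>2 = 1"
      then have "\<sigma>' i = inverse (\<sigma> i)"
        using True nz by (simp add: field_simps power2_eq_square)
      with nd show False by simp
    qed
    then show ?thesis
      unfolding zeta_num_def zeta_den_def if_P[OF True] by (intro comaximal_linear)
  next
    case False
    have "\<sigma> i * \<sigma>' i \<noteq> 1" "\<sigma> i * \<sigma>' i \<noteq> - 1" "- (\<sigma> i / \<sigma>' i) \<noteq> 1" "- (\<sigma> i / \<sigma>' i) \<noteq> - 1"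
    proof -
      show "\<sigma> i * \<sigma>' i \<noteq> 1"
        using nd inverse_unique[of "\<sigma> i" "\<sigma>' i"] by fastforce
      show "\<sigma> i * \<sigma>' i \<noteq> - 1"
      proof
        assume "\<sigma> i * \<sigma>' i = - 1"
        then have "\<sigma>' i = - inverse (\<sigma> i)" using nz by (simp add: field_simps)
        with nd show False by simp
      qed
      show "- (\<sigma> i / \<sigma>' i) \<noteq> 1"
      proof
        assume "- (\<sigma> i / \<sigma>' i) = 1"
        then have "\<sigma>' i = - \<sigma> i" using nz by (simp add: field_simps)
        with nd show False by simp
      qed
      show "- (\<sigma> i / \<sigma>' i) \<noteq> - 1" using False nz by simp
    qed
    then show ?thesis
      unfolding zeta_num_def zeta_den_def if_not_P[OF False]
      by (intro comaximal_mult comaximal_sym[OF comaximal_mult] comaximal_linear[THEN comaximal_sym])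
         auto
  qed
qed

lemma zeta_simple_eq:
  assumes i: "i \<in> I"
  shows "zeta_simple S \<sigma> \<sigma>' i = Fract (zeta_num i) (zeta_den i)"
proof -
  note nz = sigma_nonzero[OF i]
  let ?s = "ga_const (\<sigma> i)" and ?t = "ga_const (\<sigma>' i)"
    and ?s' = "ga_const (inverse (\<sigma> i))" and ?t' = "ga_const (inverse (\<sigma>' i))"
  have inv: "?s * ?s' = (1::('y, 'f) group_algebra)" "?t * ?t' = (1::('y, 'f) group_algebra)"
    using nz by (simp_all flip: ga_const_mult)
  have sq: "1 - X i * X i = (1 - ga_const 1 * X i) * (1 - ga_const (- 1) * X i)"
    by (simp add: algebra_simps)
  have sq_nz: "1 - X i * X i \<noteq> 0"
    unfolding sq using one_minus_const_X_nonzero[OF i] by (metis mult_eq_0_iff)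
  have num: "- ?s * (?s - ?s' + (?t - ?t') * X i) + ?s * ?s * (1 - X i * X i)
      = (1 - ?s * ?t * X i) * (1 - (- (?s * ?t')) * X i)"
  proof -
    \<comment> \<open>The explicit factor 1 in the quadratic term is kept to be rewritten as
      \<open>?t * ?t'\<close>, which makes the factorization visible.\<close>
    have "- ?s * (?s - ?s' + (?t - ?t') * X i) + ?s * ?s * (1 - X i * X i)
      = ?s * ?s' - ?s * (?t - ?t') * X i - ?s * ?s * 1 * X i * X i"
      by (simp add: algebra_simps)
    also have "\<dots> = 1 - ?s * (?t - ?t') * X i - ?s * ?s * (?t * ?t') * X i * X i"
      by (simp only: inv)
    also have "\<dots> = (1 - ?s * ?t * X i) * (1 - (- (?s * ?t')) * X i)"
      by (simp add: algebra_simps)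
    finally show ?thesis .
  qed
  have "zeta_simple S \<sigma> \<sigma>' i
      = - Fract ?s 1 * Fract (?s - ?s' + (?t - ?t') * X i) (1 - X i * X i) + Fract (?s * ?s) 1"
    unfolding zeta_simple_def Q_fract_def X_square to_fract_def
    by (simp add: power2_eq_square)
  also have "\<dots> = Fract (- ?s * (?s - ?s' + (?t - ?t') * X i) + ?s * ?s * (1 - X i * X i))
                    (1 - X i * X i)"
    using sq_nz by (simp add: algebra_simps)
  also have "\<dots> = Fract ((1 - ?s * ?t * X i) * (1 - (- (?s * ?t')) * X i)) (1 - X i * X i)"
    by (simp only: num)
  also have "\<dots> = Fract (zeta_num i) (zeta_den i)"
  proof (cases "\<sigma> i = \<sigma>' i")
    case True
    have "(1 - ?s * ?t * X i) * (1 - (- (?s * ?t')) * X i) = zeta_num i * (1 + X i)"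
      using True inv by (simp add: zeta_num_def power2_eq_square)
    moreover have "1 - X i * X i = zeta_den i * (1 + X i)"
      using True by (simp add: zeta_den_def algebra_simps)
    ultimately show ?thesis
      using sq_nz zeta_den_nonzero[OF i] by (simp add: eq_fract)
  next
    case False
    then show ?thesis by (simp add: zeta_num_def zeta_den_def sq divide_inverse)
  qed
  finally show ?thesis .
qed

lemma ga_eval_zeta_num:
  assumes "\<chi> \<in> torus"
  shows "ga_eval \<chi> (zeta_num i) = (if \<sigma> i = \<sigma>' i then 1 - (\<sigma> i)\<^sup>2 * \<chi> (- scoroot i)
     else (1 - \<sigma> i * \<sigma>' i * \<chi> (- scoroot i)) * (1 + \<sigma> i / \<sigma>' i * \<chi> (- scoroot i)))"
  unfolding zeta_num_def
  by (simp add: ga_eval_hom[OF assms] del: ga_const_simps ga_const_mult)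

lemma torus_comp_W: "\<chi> \<in> torus \<Longrightarrow> w \<in> W \<Longrightarrow> \<chi> \<circ> w \<in> torus"
  by (simp add: torus_def W_add)

lemma torus_act_eq: "torus_act w \<chi> = \<chi> \<circ> inv w"
  by (simp add: torus_act_def fun_eq_iff)

text \<open>Units of the group algebra do not vanish at \<tau>, so any reduced numerator may be
  replaced by the transported \<open>zeta_num i\<close>; evaluating that at \<tau> is evaluating
  \<open>zeta_num i\<close> at \<tau> composed with w.\<close>

lemma mem_U_iff:
  assumes \<tau>: "\<tau> \<in> torus"
  shows "\<tau> \<in> \<U> S \<sigma> \<sigma>' \<longleftrightarrow> (\<forall>w\<in>W. \<forall>i\<in>I. ga_eval (\<tau> \<circ> w) (zeta_num i) \<noteq> 0)"
proof -
  have zeta: "fract_act w (zeta_simple S \<sigma> \<sigma>' i) = Fract (ga_act w (zeta_num i)) (ga_act w (zeta_den i))"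
    "comaximal (ga_act w (zeta_num i)) (ga_act w (zeta_den i))" "ga_act w (zeta_den i) \<noteq> 0"
    if wi: "w \<in> W" "i \<in> I" for w i
  proof -
    note w = W_inverse(1)[OF wi(1)] W_add[OF wi(1)]
    show "fract_act w (zeta_simple S \<sigma> \<sigma>' i) = Fract (ga_act w (zeta_num i)) (ga_act w (zeta_den i))"
      unfolding zeta_simple_eq[OF wi(2)] using w zeta_den_nonzero[OF wi(2)]
      by (rule fract_act_Fract)
    show "ga_act w (zeta_den i) \<noteq> 0" using zeta_den_nonzero[OF wi(2)] w(1) by (simp add: ga_act_eq_0_iff)
    obtain u v where "u * zeta_num i + v * zeta_den i = 1"
      using comaximal_zeta[OF wi(2)] unfolding comaximal_def by blast
    then have "ga_act w (u * zeta_num i + v * zeta_den i) = ga_act w 1" by simp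
    moreover have "ga_act w 1 = (1 :: ('y, 'f) group_algebra)"
      using ga_act_monom[of w "1::'f" 0] W_zero[OF wi(1)] by simp
    ultimately show "comaximal (ga_act w (zeta_num i)) (ga_act w (zeta_den i))"
      unfolding comaximal_def by (metis ga_act_add ga_act_mult[OF w(2)])
  qed
  show ?thesis
  proof
    assume U: "\<tau> \<in> \<U> S \<sigma> \<sigma>'"
    show "\<forall>w\<in>W. \<forall>i\<in>I. ga_eval (\<tau> \<circ> w) (zeta_num i) \<noteq> 0"
    proof (intro ballI)
      fix w i assume wi: "w \<in> W" "i \<in> I"
      then have "w (scoroot i) \<in> coroots S" by (auto simp: coroots_def)
      moreover have "is_zeta S \<sigma> \<sigma>' (w (scoroot i)) (fract_act w (zeta_simple S \<sigma> \<sigma>' i))"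
        using wi by (auto simp: is_zeta_def)
      ultimately have "ga_eval \<tau> (ga_act w (zeta_num i)) \<noteq> 0"
        using U zeta[OF wi] comaximal_imp_coprime unfolding \<U>_def by blast
      then show "ga_eval (\<tau> \<circ> w) (zeta_num i) \<noteq> 0" by (simp add: ga_eval_act)
    qed
  next
    assume ne: "\<forall>w\<in>W. \<forall>i\<in>I. ga_eval (\<tau> \<circ> w) (zeta_num i) \<noteq> 0"
    have "ga_eval \<tau> num \<noteq> 0"
      if z: "is_zeta S \<sigma> \<sigma>' a z" "coprime num den" "den \<noteq> 0" "z = Fract num den" for a z num den
    proof -
      obtain w i where wi: "w \<in> W" "i \<in> I" "z = fract_act w (zeta_simple S \<sigma> \<sigma>' i)"
        using z(1) by (auto simp: is_zeta_def)
      then have "Fract num den = Fract (ga_act w (zeta_num i)) (ga_act w (zeta_den i))"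
        using zeta(1) z(4) by simp
      from coprime_Fract_eq_comaximal[OF z(2,3) zeta(2,3)[OF wi(1,2)] this]
      obtain c where c: "is_unit c" "num = c * ga_act w (zeta_num i)" .
      then obtain d where "1 = c * d" by (auto simp: dvd_def)
      then have "ga_eval \<tau> c \<noteq> 0"
        using ga_eval_hom(1)[OF \<tau>, of c d] ga_eval_hom(4)[OF \<tau>] by auto
      then show ?thesis using c(2) ne wi by (simp add: ga_eval_hom[OF \<tau>] ga_eval_act)
    qed
    then show "\<tau> \<in> \<U> S \<sigma> \<sigma>'" using \<tau> unfolding \<U>_def by blast
  qed
qed

text \<open>The value of \<open>Q\<^sub>i\<close> at a point \<open>\<chi>\<close> that \<open>srefl i\<close> does not fix. If the denominator vanishes
  there, then \<open>\<sigma> i = \<sigma>' i\<close> and the factor \<open>1 + X i\<close> cancels.\<close>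

definition Q_at :: "'i \<Rightarrow> ('y \<Rightarrow> 'f) \<Rightarrow> 'f" where
  "Q_at i \<chi> = (let x = \<chi> (- scoroot i) in
     if x * x = 1 then (\<sigma> i - inverse (\<sigma> i)) / 2
     else (\<sigma> i - inverse (\<sigma> i) + (\<sigma>' i - inverse (\<sigma>' i)) * x) / (1 - x * x))"

text \<open>Write x for the value of \<chi> at the negative coroot. The reflection multiplies \<chi>
  \<mu> by x to the power \<open>sroot i \<mu>\<close>. If x^2 = 1 and \<chi> moves, then x is not 1
  and some \<open>sroot i \<mu>\<close> is odd; since the coroot has root value 2, the root is then
  surjective, and \<open>hecke_parameters\<close> forces equal parameters.\<close>

lemma regular_cases:
  assumes i: "i \<in> I" and \<chi>: "\<chi> \<in> torus" and reg: "\<chi> \<circ> srefl i \<noteq> \<chi>"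
    and sq: "\<chi> (- scoroot i) * \<chi> (- scoroot i) = 1"
  shows "\<chi> (- scoroot i) = - 1" and "\<sigma> i = \<sigma>' i"
proof -
  let ?\<alpha> = "- scoroot i"
  obtain \<mu> where "\<chi> (srefl i \<mu>) \<noteq> \<chi> \<mu>" using reg by (auto simp: fun_eq_iff)
  moreover have "\<chi> (srefl i \<mu>) = \<chi> \<mu> * \<chi> (zsmult (sroot i \<mu>) ?\<alpha>)"
    by (simp add: simple_refl_def flip: torus_add[OF \<chi>])
  ultimately have ne: "\<chi> (zsmult (sroot i \<mu>) ?\<alpha>) \<noteq> 1" by auto
  have "\<chi> ?\<alpha> \<noteq> 1" using ne torus_zsmult_eq_1[OF \<chi>] by blast
  with sq show "\<chi> ?\<alpha> = - 1" by (simp add: square_eq_1_iff)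
  have "\<chi> (zsmult 2 ?\<alpha>) = 1"
    using sq torus_add[OF \<chi>, of ?\<alpha> ?\<alpha>] zsmult_add_left[of 1 1 ?\<alpha>] by simp
  then have even: "\<chi> (zsmult (m * 2) ?\<alpha>) = 1" for m
    using torus_zsmult_eq_1[OF \<chi>, of "zsmult 2 ?\<alpha>" m] by (simp only: zsmult_mult)
  have "odd (sroot i \<mu>)"
  proof
    assume "even (sroot i \<mu>)"
    then obtain m where "sroot i \<mu> = m * 2" by (auto elim: evenE)
    with even ne show False by simp
  qed
  then obtain m where m: "sroot i \<mu> = 2 * m + 1" by (auto elim: oddE)
  \<comment> \<open>Subtracting m coroots from \<mu> leaves an element of root value 1, whose
    multiples take every integer value.\<close>
  have "sroot i (zsmult k (\<mu> - zsmult m (scoroot i))) = k" for k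
    using m i by (simp add: root_zsmult root_diff)
  then have "range (sroot i) = UNIV" unfolding surj_def by metis
  then show "\<sigma> i = \<sigma>' i" using hecke_parameters i by (simp add: hecke_parameters_def)
qed

text \<open>Identifies the value at \<chi> of the correction term in the Bernstein--Lusztig
  relation: clear the denominator, evaluate, divide.\<close>

lemma Q_at_eval:
  assumes i: "i \<in> I" and \<chi>: "\<chi> \<in> torus" and reg: "\<chi> \<circ> srefl i \<noteq> \<chi>"
    and p: "to_fract p = Q_fract S \<sigma> \<sigma>' i * to_fract (ga_Z \<mu> - ga_Z (srefl i \<mu>))"
  shows "ga_eval \<chi> p = Q_at i \<chi> * (\<chi> \<mu> - \<chi> (srefl i \<mu>))"
proof -
  let ?a = "\<sigma> i - inverse (\<sigma> i)" and ?b = "\<sigma>' i - inverse (\<sigma>' i)"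
  let ?d = "ga_Z \<mu> - ga_Z (srefl i \<mu>) :: ('y, 'f) group_algebra"
  let ?x = "\<chi> (- scoroot i)"
  have sq: "1 - X i * X i = (1 - ga_const 1 * X i) * (1 - ga_const (- 1) * X i)"
    by (simp add: algebra_simps)
  have sq_nz: "1 - X i * X i \<noteq> 0"
    unfolding sq using one_minus_const_X_nonzero[OF i] by (metis mult_eq_0_iff)
  have eq: "p * (1 - X i * X i) = (ga_const ?a + ga_const ?b * X i) * ?d"
    using p sq_nz unfolding Q_fract_def X_square to_fract_def by (simp add: eq_fract)
  show ?thesis
  proof (cases "?x * ?x = 1")
    case False
    have "ga_eval \<chi> (p * (1 - X i * X i)) = ga_eval \<chi> ((ga_const ?a + ga_const ?b * X i) * ?d)"
      by (simp only: eq)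
    then have "ga_eval \<chi> p * (1 - ?x * ?x) = (?a + ?b * ?x) * (\<chi> \<mu> - \<chi> (srefl i \<mu>))"
      unfolding ga_eval_hom[OF \<chi>] ga_eval_add .
    then have "ga_eval \<chi> p = (?a + ?b * ?x) * (\<chi> \<mu> - \<chi> (srefl i \<mu>)) / (1 - ?x * ?x)"
      using False by (subst nonzero_eq_divide_eq) auto
    moreover have "Q_at i \<chi> = (?a + ?b * ?x) / (1 - ?x * ?x)"
      using False by (simp add: Q_at_def Let_def)
    ultimately show ?thesis by (simp only: times_divide_eq_left)
  next
    case True
    note c = regular_cases[OF i \<chi> reg True]
    \<comment> \<open>The factor 1 + X evaluates to 0 here, so it has to be cancelled in the group
      algebra first. What remains is 1 - X, with value 2: the origin of the 2 in
      \<open>Q_at\<close>.\<close>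
    have "p * (1 - ga_const 1 * X i) * (1 - ga_const (- 1) * X i)
        = p * (1 - X i * X i)" by (simp only: sq mult.assoc)
    also have "\<dots> = ga_const ?a * ?d * (1 - ga_const (- 1) * X i)"
      unfolding eq using c(2) by (simp add: algebra_simps)
    finally have "p * (1 - ga_const 1 * X i) = ga_const ?a * ?d"
      by (metis mult_right_cancel one_minus_const_X_nonzero[OF i])
    then have "ga_eval \<chi> (p * (1 - ga_const 1 * X i)) = ga_eval \<chi> (ga_const ?a * ?d)"
      by (simp only:)
    then have "ga_eval \<chi> p * (1 - 1 * ?x) = ?a * (\<chi> \<mu> - \<chi> (srefl i \<mu>))"
      unfolding ga_eval_hom[OF \<chi>] .
    then have "ga_eval \<chi> p * 2 = ?a * (\<chi> \<mu> - \<chi> (srefl i \<mu>))" using c(1) by simp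
    then have "ga_eval \<chi> p = ?a * (\<chi> \<mu> - \<chi> (srefl i \<mu>)) / 2"
      by (subst nonzero_eq_divide_eq) auto
    moreover have "Q_at i \<chi> = ?a / 2" using True by (simp add: Q_at_def Let_def)
    ultimately show ?thesis by (simp only: times_divide_eq_left)
  qed
qed

text \<open>Put a = \<sigma> - 1/\<sigma> and b = \<sigma>' - 1/\<sigma>'. The reflection inverts x,
  and off the pole (a + b/x) / (1 - 1/x^2) = -(a x^2 + b x) / (1 - x^2), so the terms in b cancel.
  The sum is the linear coefficient in \<open>H_square\<close>, which makes two opposite
  intertwiners compose to a scalar.\<close>

lemma Q_at_refl:
  assumes "i \<in> I" and \<chi>: "\<chi> \<in> torus"
    and reg: "\<chi> \<circ> srefl i \<noteq> \<chi>"
  shows "Q_at i \<chi> + Q_at i (\<chi> \<circ> srefl i) = \<sigma> i - inverse (\<sigma> i)"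
proof -
  let ?x = "\<chi> (- scoroot i)"
  have x: "(\<chi> \<circ> srefl i) (- scoroot i) = inverse ?x"
    using assms(1) \<chi> by (simp add: W_minus[OF refl_in_W] refl_coroot torus_minus)
  have nz: "?x \<noteq> 0" using \<chi> by (rule torus_nonzero)
  show ?thesis
  proof (cases "?x * ?x = 1")
    case True
    then have "inverse ?x * inverse ?x = 1" by (metis inverse_1 inverse_mult_distrib)
    with True show ?thesis unfolding Q_at_def Let_def x by simp
  next
    case False
    have ne: "inverse ?x * inverse ?x \<noteq> 1" using False nz by (simp add: field_simps)
    let ?a = "\<sigma> i - inverse (\<sigma> i)" and ?b = "\<sigma>' i - inverse (\<sigma>' i)"
    have q: "Q_at i \<chi> * (1 - ?x * ?x) = ?a + ?b * ?x"
      unfolding Q_at_def Let_def using False by simp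
    have "Q_at i (\<chi> \<circ> srefl i) * (1 - inverse ?x * inverse ?x) = ?a + ?b * inverse ?x"
      unfolding Q_at_def Let_def x using ne by simp
    then have "Q_at i (\<chi> \<circ> srefl i) * ((1 - inverse ?x * inverse ?x) * (?x * ?x))
        = (?a + ?b * inverse ?x) * (?x * ?x)"
      by (simp only: mult.assoc[symmetric])
    then have q': "Q_at i (\<chi> \<circ> srefl i) * (?x * ?x - 1) = ?a * (?x * ?x) + ?b * ?x"
      using nz by (simp add: algebra_simps)
    have "(Q_at i \<chi> + Q_at i (\<chi> \<circ> srefl i)) * (1 - ?x * ?x)
        = Q_at i \<chi> * (1 - ?x * ?x) - Q_at i (\<chi> \<circ> srefl i) * (?x * ?x - 1)"
      by (simp add: algebra_simps)
    also have "\<dots> = ?a * (1 - ?x * ?x)" unfolding q q' by (simp add: algebra_simps)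
    finally show ?thesis using False by simp
  qed
qed

text \<open>The value of zeta at \<chi> is \<sigma> (\<sigma> - Q), so it vanishes together with the
  reduced numerator. For equal parameters the unreduced numerator has the extra factor 1 + x, which
  is nonzero off the pole.\<close>

lemma Q_at_eq_sigma_iff:
  assumes i: "i \<in> I" and \<chi>: "\<chi> \<in> torus" and reg: "\<chi> \<circ> srefl i \<noteq> \<chi>"
  shows "Q_at i \<chi> = \<sigma> i \<longleftrightarrow> ga_eval \<chi> (zeta_num i) = 0"
proof -
  let ?x = "\<chi> (- scoroot i)"
  note nz = sigma_nonzero[OF i]
  show ?thesis
  proof (cases "?x * ?x = 1")
    case True
    note c = regular_cases[OF i \<chi> reg True]
    then show ?thesis
      using nz True unfolding ga_eval_zeta_num[OF \<chi>] Q_at_def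
      by (auto simp: field_simps power2_eq_square)
  next
    case False
    have d: "1 - ?x * ?x \<noteq> 0" using False by simp
    have "\<sigma> i * (\<sigma> i - Q_at i \<chi>) * (1 - ?x * ?x)
        = \<sigma> i * \<sigma> i * (1 - ?x * ?x) - \<sigma> i * (\<sigma> i - inverse (\<sigma> i) + (\<sigma>' i - inverse (\<sigma>' i)) * ?x)"
    proof -
      have q: "Q_at i \<chi> * (1 - ?x * ?x) = \<sigma> i - inverse (\<sigma> i) + (\<sigma>' i - inverse (\<sigma>' i)) * ?x"
        unfolding Q_at_def Let_def using False by simp
      have "\<sigma> i * (\<sigma> i - Q_at i \<chi>) * (1 - ?x * ?x)
          = \<sigma> i * \<sigma> i * (1 - ?x * ?x) - \<sigma> i * (Q_at i \<chi> * (1 - ?x * ?x))"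
        by (simp add: algebra_simps)
      then show ?thesis by (simp only: q)
    qed
    also have "\<dots> = (1 - \<sigma> i * \<sigma>' i * ?x) * (1 + \<sigma> i / \<sigma>' i * ?x)"
      using nz by (simp add: field_simps)
    finally have eq: "\<sigma> i * (\<sigma> i - Q_at i \<chi>) * (1 - ?x * ?x)
        = (1 - \<sigma> i * \<sigma>' i * ?x) * (1 + \<sigma> i / \<sigma>' i * ?x)" .
    have "Q_at i \<chi> = \<sigma> i \<longleftrightarrow> \<sigma> i * (\<sigma> i - Q_at i \<chi>) * (1 - ?x * ?x) = 0"
      using nz d by auto
    also have "\<dots> \<longleftrightarrow> ga_eval \<chi> (zeta_num i) = 0"
    proof (cases "\<sigma> i = \<sigma>' i")
      case True
      have "1 + ?x \<noteq> 0" using False by (metis add_eq_0_iff minus_mult_minus mult_1)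
      with True nz show ?thesis
        unfolding eq ga_eval_zeta_num[OF \<chi>] by (simp add: power2_eq_square)
    qed (simp add: eq ga_eval_zeta_num[OF \<chi>])
    finally show ?thesis .
  qed
qed

end

section \<open>Unitriangular changes of basis\<close>

context vector_space
begin

text \<open>Among the indices with nonzero coefficient take m of maximal rank. Lower terms have
  strictly smaller rank, so b m occurs in f m alone, with coefficient 1, and the sum has coordinate
  c m there.\<close>

lemma unitriangular_independent:
  fixes b f :: "'k \<Rightarrow> 'b" and rank :: "'k \<Rightarrow> nat"
  assumes inj: "inj_on b K" and indep: "independent (b ` K)"
    and tri: "\<And>k. k \<in> K \<Longrightarrow> f k - b k \<in> span (b ` {k' \<in> K. rank k' < rank k})"
    and A: "finite A" "A \<subseteq> K" and zero: "(\<Sum>k\<in>A. scale (c k) (f k)) = 0" and k: "k \<in> A"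
  shows "c k = 0"
proof (rule ccontr)
  assume ck: "c k \<noteq> 0"
  define A' where "A' = {k \<in> A. c k \<noteq> 0}"
  have A': "finite A'" "A' \<subseteq> K" "k \<in> A'" using A k ck by (auto simp: A'_def)
  have "Max (rank ` A') \<in> rank ` A'" using A' by (intro Max_in) auto
  then obtain m where m: "m \<in> A'" "rank m = Max (rank ` A')" by auto
  have max: "rank k' \<le> rank m" if "k' \<in> A'" for k' using that A' m by simp
  let ?R = "\<lambda>x. representation (b ` K) x (b m)"
  have in_span: "f k' \<in> span (b ` K)" if "k' \<in> K" for k'
  proof -
    have "f k' - b k' \<in> span (b ` K)"
      using tri[OF that] span_mono[of "b ` {l \<in> K. rank l < rank k'}" "b ` K"] by blast
    moreover have "b k' \<in> span (b ` K)" using that by (intro span_base) auto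
    ultimately show ?thesis using span_add[of "b k'" "b ` K" "f k' - b k'"] by simp
  qed
  have R: "?R (f k') = (if k' = m then 1 else 0)" if "k' \<in> A'" for k'
  proof -
    have k': "k' \<in> K" and mK: "m \<in> K" using that m A' by auto
    let ?B = "b ` {l \<in> K. rank l < rank k'}"
    have sub: "?B \<subseteq> b ` K" by auto
    have "b m \<notin> ?B"
    proof
      assume "b m \<in> ?B"
      then obtain l where "l \<in> K" "rank l < rank k'" "b m = b l" by blast
      moreover from this have "m = l" using inj mK by (metis inj_onD)
      ultimately show False using max[OF that] by simp
    qed
    then have "?R (f k' - b k') = 0"
      using representation_extend[OF indep tri[OF k'] sub]
        representation_ne_zero[of ?B "f k' - b k'" "b m"] by metis
    moreover have "?R (b k') = (if k' = m then 1 else 0)"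
      using representation_basis[OF indep, of "b k'"] k' mK inj by (auto dest: inj_onD)
    moreover have "?R (f k') = ?R (b k') + ?R (f k' - b k')"
    proof -
      have "b k' \<in> span (b ` K)" using k' by (intro span_base) auto
      moreover have "f k' - b k' \<in> span (b ` K)" using span_mono[OF sub] tri[OF k'] by blast
      ultimately show ?thesis
        using representation_add[OF indep, of "f k' - b k'" "b k'"] by (simp add: add.commute)
    qed
    ultimately show ?thesis by simp
  qed
  have "(\<Sum>k\<in>A'. scale (c k) (f k)) = 0"
    using zero A(1) unfolding A'_def by (subst (asm) sum.mono_neutral_cong_right) auto
  then have "?R (\<Sum>k\<in>A'. scale (c k) (f k)) = 0" by (simp add: representation_zero)
  moreover have "?R (\<Sum>k\<in>A'. scale (c k) (f k)) = (\<Sum>k\<in>A'. ?R (scale (c k) (f k)))"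
    using A' in_span by (subst representation_sum[OF indep]) (auto intro: span_scale)
  moreover have "\<dots> = (\<Sum>k\<in>A'. c k * (if k = m then 1 else 0))"
    using A' in_span R by (intro sum.cong) (auto simp: representation_scale[OF indep])
  moreover have "\<dots> = (\<Sum>k\<in>A'. if k = m then c k else 0)" by (rule sum.cong) auto
  moreover have "\<dots> = c m" using A' m by simp
  ultimately show False using m by (simp add: A'_def)
qed

text \<open>Induction on the rank. It is applied later also to families \<open>H w * y\<close> that
  may be dependent.\<close>

lemma unitriangular_span:
  fixes b f :: "'k \<Rightarrow> 'b" and rank :: "'k \<Rightarrow> nat"
  assumes tri: "\<And>k. k \<in> K \<Longrightarrow> f k - b k \<in> span (b ` {k' \<in> K. rank k' < rank k})"
    and k: "k \<in> K"
  shows "b k \<in> span (f ` K)"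
  using k
proof (induction "rank k" arbitrary: k rule: less_induct)
  case less
  have "span (b ` {k' \<in> K. rank k' < rank k}) \<subseteq> span (f ` K)"
    by (rule span_minimal) (use less in auto)
  then have "f k - b k \<in> span (f ` K)" using tri[OF less.prems] by blast
  moreover have "f k \<in> span (f ` K)" using less.prems by (intro span_base) auto
  ultimately show ?case using span_diff[of "f k" "f ` K" "f k - b k"] by simp
qed

text \<open>Such functionals are used to show that vectors lie outside a left ideal. Independence of
  the indexed family f yields first its injectivity and then independence of its image, on which
  values can be prescribed.\<close>

lemma unitriangular_functional:
  fixes b f :: "'k \<Rightarrow> 'b" and rank :: "'k \<Rightarrow> nat"
  assumes inj: "inj_on b K" and indep: "independent (b ` K)" 
    and tri: "\<And>k. k \<in> K \<Longrightarrow> f k - b k \<in> span (b ` {k' \<in> K. rank k' < rank k})"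
  obtains g where "\<And>x y. g (x + y) = g x + g y" "\<And>c x. g (scale c x) = c * g x"
    "\<And>k. k \<in> K \<Longrightarrow> g (f k) = \<phi> k"
proof -
  have ind: "c k = 0" if "finite A" "A \<subseteq> K" "(\<Sum>k\<in>A. scale (c k) (f k)) = 0" "k \<in> A" for A c k
    by (rule unitriangular_independent[OF inj indep _ that]) (rule tri)
  have inj_f: "inj_on f K"
  proof (rule inj_onI, rule ccontr)
    fix k l assume *: "k \<in> K" "l \<in> K" "f k = f l" "k \<noteq> l"
    have "(\<Sum>j\<in>{k, l}. scale (if j = k then 1 else - 1) (f j)) = 0" using * by simp
    from ind[OF _ _ this] * show False by force
  qed
  have "independent (f ` K)"
    unfolding independent_explicit_finite_subsets
  proof (intro allI impI ballI)
    fix A u v assume A: "A \<subseteq> f ` K" "finite A" and z: "(\<Sum>v\<in>A. scale (u v) v) = 0" and v: "v \<in> A"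
    obtain B where B: "B \<subseteq> K" "inj_on f B" "A = f ` B"
      using A(1) unfolding subset_image_inj by blast
    have "finite B" using A B finite_image_iff by blast
    moreover have "(\<Sum>k\<in>B. scale (u (f k)) (f k)) = 0"
      using z unfolding B(3) by (simp add: sum.reindex[OF B(2)])
    ultimately show "u v = 0" using ind[of B "\<lambda>k. u (f k)"] B v by auto
  qed
  interpret pair: vector_space_pair scale "(*) :: 'a \<Rightarrow> 'a \<Rightarrow> 'a"
    by unfold_locales (simp_all add: algebra_simps)
  let ?g = "pair.construct (f ` K) (\<lambda>v. \<phi> (inv_into K f v))"
  have lin: "Vector_Spaces.linear scale (*) ?g"
    using \<open>independent (f ` K)\<close> by (rule pair.linear_construct)
  show thesis
  proof (rule that[of ?g])
    show "?g (x + y) = ?g x + ?g y" for x y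
      using lin by (rule pair.linear_add)
    show "?g (scale c x) = c * ?g x" for c x
      using lin by (rule pair.linear_scale)
    show "?g (f k) = \<phi> k" if "k \<in> K" for k
      using pair.construct_basis[OF \<open>independent (f ` K)\<close>, of "f k"] that inj_f by simp
  qed
qed

lemma in_span_image_sum:
  assumes "x \<in> span (v ` K)"
  obtains A c where "finite A" "A \<subseteq> K" "x = (\<Sum>k\<in>A. scale (c k) (v k))"
proof -
  obtain t r where t: "finite t" "t \<subseteq> v ` K" "x = (\<Sum>a\<in>t. scale (r a) a)"
    using assms unfolding span_explicit by blast
  obtain A where A: "A \<subseteq> K" "inj_on v A" "t = v ` A"
    using t(2) unfolding subset_image_inj by blast
  show thesis
    by (rule that[of A "\<lambda>k. r (v k)"]) (use A t finite_image_iff in \<open>auto simp: sum.reindex\<close>)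
qed

end

section \<open>The Bernstein--Lusztig relations\<close>

locale BL_hecke = hecke_datum S \<sigma> \<sigma>'
  for S :: "('i, 'x::fg_free_abelian, 'y::fg_free_abelian) root_data"
    and \<sigma> \<sigma>' :: "'i \<Rightarrow> 'f::field_char_0" +
  fixes scale :: "'f \<Rightarrow> 'h::ring_1 \<Rightarrow> 'h" and ZH :: "'y \<Rightarrow> ('y \<Rightarrow> 'y) \<Rightarrow> 'h"
  assumes BL: "BL_hecke_algebra S \<sigma> \<sigma>' scale ZH"
begin

sublocale vector_space scale
  using BL by (simp add: BL_hecke_algebra_def)

abbreviation "H w \<equiv> ZH 0 w"
abbreviation "Z \<mu> \<equiv> ZH \<mu> id"
abbreviation "emb \<equiv> ga_embed scale ZH"

lemma scale_mult_left: "scale c a * b = scale c (a * b)"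
  using BL by (simp add: BL_hecke_algebra_def)

lemma scale_mult_right: "a * scale c b = scale c (a * b)"
  using BL unfolding BL_hecke_algebra_def by metis

lemma ZH_inj: "inj_on (\<lambda>(\<mu>, w). ZH \<mu> w) (UNIV \<times> W)"
  and ZH_independent: "independent ((\<lambda>(\<mu>, w). ZH \<mu> w) ` (UNIV \<times> W))"
  and ZH_span: "span ((\<lambda>(\<mu>, w). ZH \<mu> w) ` (UNIV \<times> W)) = UNIV"
  using BL unfolding BL_hecke_algebra_def by auto

lemma Z_mult_H: "w \<in> W \<Longrightarrow> Z \<mu> * H w = ZH \<mu> w"
  using BL by (simp add: BL_hecke_algebra_def)

lemma Z_mult_Z: "Z \<mu> * Z \<nu> = Z (\<mu> + \<nu>)"
  using BL by (simp add: BL_hecke_algebra_def)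

lemma H_mult_longer:
  "i \<in> I \<Longrightarrow> w \<in> W \<Longrightarrow> len S (srefl i \<circ> w) = len S w + 1 \<Longrightarrow> H (srefl i) * H w = H (srefl i \<circ> w)"
  using BL unfolding BL_hecke_algebra_def by blast

lemma H_mult_shorter:
  "i \<in> I \<Longrightarrow> w \<in> W \<Longrightarrow> len S w = len S (srefl i \<circ> w) + 1
    \<Longrightarrow> H (srefl i) * H w = scale (\<sigma> i - inverse (\<sigma> i)) (H w) + H (srefl i \<circ> w)"
  using BL unfolding BL_hecke_algebra_def by blast

lemma H_mult_Z:
  assumes "i \<in> I"
  obtains p where "to_fract p = Q_fract S \<sigma> \<sigma>' i * to_fract (ga_Z \<mu> - ga_Z (srefl i \<mu>))"
    "H (srefl i) * Z \<mu> = Z (srefl i \<mu>) * H (srefl i) + emb p"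
proof -
  obtain p where "to_fract p = Q_fract S \<sigma> \<sigma>' i * to_fract (ga_Z \<mu> - ga_Z (srefl i \<mu>))"
    "H (srefl i) * Z \<mu> - Z (srefl i \<mu>) * H (srefl i) = emb p"
    using BL assms unfolding BL_hecke_algebra_def by blast
  then show thesis using that by (simp add: diff_eq_eq add.commute)
qed

lemma Z_mult_ZH: "w \<in> W \<Longrightarrow> Z \<mu> * ZH \<nu> w = ZH (\<mu> + \<nu>) w"
  by (metis Z_mult_H Z_mult_Z mult.assoc)

lemma span_mult_left:
  assumes "x \<in> span A" and "subspace T" and "\<And>a. a \<in> A \<Longrightarrow> h * a \<in> T"
  shows "h * x \<in> T"
proof -
  have "subspace {x. h * x \<in> T}"
    using assms(2) by (auto simp: subspace_def distrib_left scale_mult_right)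
  then show ?thesis using span_induct[of x A "\<lambda>x. h * x \<in> T"] assms by simp
qed

text \<open>\<open>Z 0\<close> fixes every basis vector under left multiplication, hence the whole
  span, and in particular 1.\<close>

lemma Z_zero: "Z 0 = 1"
proof -
  have "Z 0 * x = x" for x
  proof -
    have sub: "subspace {x. Z 0 * x = x}"
      by (auto simp: subspace_def distrib_left scale_mult_right)
    have "x \<in> span ((\<lambda>(\<mu>, w). ZH \<mu> w) ` (UNIV \<times> W))" using ZH_span by simp
    from this sub show ?thesis by (rule span_induct) (auto simp: Z_mult_ZH)
  qed
  then show ?thesis by (metis mult_1_right)
qed

lemma scale_eq_mult: "scale c x = scale c 1 * x"
  by (simp add: scale_mult_left)

lemma H_square: "i \<in> I \<Longrightarrow> H (srefl i) * H (srefl i) = scale (\<sigma> i - inverse (\<sigma> i)) (H (srefl i)) + 1"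
  using H_mult_shorter[of i "srefl i"] refl_refl_comp[of i id] by (simp add: Z_zero)

subsection \<open>Filtration by length\<close>

text \<open>The inequality is strict, so \<open>Fil (len S w)\<close> collects exactly what counts
  as lower than \<open>w\<close>.\<close>

definition Fil :: "nat \<Rightarrow> 'h set" where
  "Fil n = span ((\<lambda>(\<mu>, w). ZH \<mu> w) ` {(\<mu>, w). w \<in> W \<and> len S w < n})"

lemma subspace_Fil [simp]: "subspace (Fil n)"
  by (simp add: Fil_def)

lemma ZH_in_Fil: "w \<in> W \<Longrightarrow> len S w < n \<Longrightarrow> ZH \<mu> w \<in> Fil n"
  unfolding Fil_def by (rule span_base) auto

lemma Fil_mult_left:
  assumes "x \<in> Fil n" and "subspace T" and "\<And>\<mu> w. w \<in> W \<Longrightarrow> len S w < n \<Longrightarrow> h * ZH \<mu> w \<in> T"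
  shows "h * x \<in> T"
  by (rule span_mult_left[OF assms(1)[unfolded Fil_def] assms(2)]) (use assms(3) in auto)

lemma emb_mult_Fil: "x \<in> Fil n \<Longrightarrow> emb p * x \<in> Fil n"
proof -
  assume x: "x \<in> Fil n"
  have "Z \<nu> * x \<in> Fil n" for \<nu>
    by (rule Fil_mult_left[OF x]) (simp_all add: Z_mult_ZH ZH_in_Fil)
  then show ?thesis
    unfolding ga_embed_def sum_distrib_right scale_mult_left
    by (intro subspace_sum subspace_scale) simp_all
qed

lemma Z_mult_Fil: "x \<in> Fil n \<Longrightarrow> Z \<nu> * x \<in> Fil n"
  by (erule Fil_mult_left) (simp_all add: Z_mult_ZH ZH_in_Fil)

lemma H_mult_H_Fil:
  assumes "i \<in> I" and "w \<in> W" and "len S w < n"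
  shows "H (srefl i) * H w \<in> Fil (Suc n)"
  using len_refl_comp_cases[OF assms(1,2)]
proof
  assume "len S w = len S (srefl i \<circ> w) + 1"
  then show ?thesis
    using assms H_mult_shorter by (auto intro!: subspace_add subspace_scale ZH_in_Fil)
qed (use assms H_mult_longer in \<open>auto intro!: ZH_in_Fil\<close>)

text \<open>Moving \<open>H (srefl i)\<close> past \<open>Z \<mu>\<close> costs a term
  \<open>emb p\<close>, which does not raise the length; only the factor \<open>H (srefl i)\<close>
  itself can.\<close>

lemma H_mult_Fil:
  assumes "i \<in> I" and "x \<in> Fil n"
  shows "H (srefl i) * x \<in> Fil (Suc n)"
  using assms(2)
proof (rule Fil_mult_left)
  fix \<mu> w assume w: "w \<in> W" "len S w < n"
  obtain p where p: "H (srefl i) * Z \<mu> = Z (srefl i \<mu>) * H (srefl i) + emb p"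
    using H_mult_Z[OF assms(1)] by blast
  have "H (srefl i) * ZH \<mu> w = Z (srefl i \<mu>) * (H (srefl i) * H w) + emb p * H w"
    using w p by (simp add: algebra_simps flip: mult.assoc Z_mult_H[of w \<mu>])
  moreover have "emb p * H w \<in> Fil (Suc n)"
    by (intro emb_mult_Fil ZH_in_Fil) (use w in auto)
  ultimately show "H (srefl i) * ZH \<mu> w \<in> Fil (Suc n)"
    using Z_mult_Fil[OF H_mult_H_Fil[OF assms(1) w]] by (simp add: subspace_add)
qed simp

text \<open>Peel off reflections from a reduced word: each moves \<mu> by itself, and its correction
  \<open>emb p\<close> has lost one factor \<open>H\<close>, so it ends up at smaller
  length.\<close>

lemma H_mult_Z_triangular: "w \<in> W \<Longrightarrow> H w * Z \<mu> - ZH (w \<mu>) w \<in> Fil (len S w)"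
proof (induction "len S w" arbitrary: w rule: less_induct)
  case less
  show ?case
  proof (cases "w = id")
    case True
    then show ?thesis by (simp add: Z_zero subspace_0)
  next
    case False
    obtain i u where u: "i \<in> I" "u \<in> W" "w = srefl i \<circ> u" "len S w = len S u + 1"
      using W_cases_len[OF less.prems False] .
    define x where "x = H u * Z \<mu> - ZH (u \<mu>) u"
    have x: "x \<in> Fil (len S u)" unfolding x_def using less u by simp
    obtain p where p: "H (srefl i) * Z (u \<mu>) = Z (srefl i (u \<mu>)) * H (srefl i) + emb p"
      using H_mult_Z[OF u(1)] by blast
    have Hw: "H (srefl i) * H u = H w" using H_mult_longer u by simp
    have "H w * Z \<mu> = H (srefl i) * (H u * Z \<mu>)" by (simp add: mult.assoc flip: Hw)
    also have "\<dots> = H (srefl i) * Z (u \<mu>) * H u + H (srefl i) * x"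
      using u(2) by (simp add: x_def algebra_simps Z_mult_H)
    also have "\<dots> = ZH (w \<mu>) w + emb p * H u + H (srefl i) * x"
      unfolding p using Z_mult_H[OF less.prems] u(3) by (simp add: algebra_simps Hw)
    finally have "H w * Z \<mu> - ZH (w \<mu>) w = emb p * H u + H (srefl i) * x" by simp
    moreover have "emb p * H u \<in> Fil (len S w)"
      by (intro emb_mult_Fil ZH_in_Fil) (use u in auto)
    moreover have "H (srefl i) * x \<in> Fil (len S w)" using H_mult_Fil[OF u(1) x] u(4) by simp
    ultimately show ?thesis by (simp add: subspace_add)
  qed
qed

text \<open>The index (\<mu>, w) is attached to \<open>Z (inv w \<mu>)\<close> so that the leading
  term is exactly \<open>ZH \<mu> w\<close>.\<close>

lemma HZ_triangular:
  assumes "k \<in> UNIV \<times> W"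
  shows "(case k of (\<mu>, w) \<Rightarrow> H w * Z (inv w \<mu>)) - (case k of (\<mu>, w) \<Rightarrow> ZH \<mu> w)
    \<in> span ((\<lambda>(\<mu>, w). ZH \<mu> w) ` {k' \<in> UNIV \<times> W. len S (snd k') < len S (snd k)})"
proof -
  obtain \<mu> w where k: "k = (\<mu>, w)" "w \<in> W" using assms by auto
  have "w (inv w \<mu>) = \<mu>" using W_inverse(1)[OF k(2)] by (simp add: bij_is_surj surj_f_inv_f)
  moreover have "span ((\<lambda>(\<mu>, w). ZH \<mu> w) ` {k' \<in> UNIV \<times> W. len S (snd k') < len S w})
      = Fil (len S w)"
    unfolding Fil_def by (rule arg_cong) auto
  ultimately show ?thesis
    using H_mult_Z_triangular[OF k(2), of "inv w \<mu>"] unfolding k(1) prod.case snd_conv by simp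
qed

lemma HZ_span: "span ((\<lambda>(\<mu>, w). H w * Z \<mu>) ` (UNIV \<times> W)) = UNIV"
proof -
  let ?f = "\<lambda>(\<mu>, w). H w * Z (inv w \<mu>)"
  have "(\<lambda>(\<mu>, w). ZH \<mu> w) ` (UNIV \<times> W) \<subseteq> span (?f ` (UNIV \<times> W))"
    by (rule image_subsetI, rule unitriangular_span[OF HZ_triangular])
  then have "span ((\<lambda>(\<mu>, w). ZH \<mu> w) ` (UNIV \<times> W)) \<subseteq> span (?f ` (UNIV \<times> W))"
    by (simp add: span_minimal)
  moreover have "span (?f ` (UNIV \<times> W)) \<subseteq> span ((\<lambda>(\<mu>, w). H w * Z \<mu>) ` (UNIV \<times> W))"
    by (rule span_mono) auto
  ultimately have "UNIV \<subseteq> span ((\<lambda>(\<mu>, w). H w * Z \<mu>) ` (UNIV \<times> W))"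
    unfolding ZH_span by (rule order.trans)
  then show ?thesis by (rule top.extremum_uniqueI)
qed

text \<open>For a character \<tau> this is the coefficient of \<open>H w\<close> in the induced
  module, lifted to the algebra; see \<open>leading_notin_J\<close>.\<close>

lemma HZ_functional:
  assumes "w \<in> W"
  obtains g where "\<And>x y. g (x + y) = g x + g y" "\<And>c x. g (scale c x) = c * g x"
    "\<And>\<mu> u. u \<in> W \<Longrightarrow> g (H u * Z \<mu>) = (if u = w then \<tau> \<mu> else 0)"
proof -
  obtain g where g: "\<And>x y. g (x + y) = g x + g y" "\<And>c x. g (scale c x) = c * g x"
    "\<And>k. k \<in> UNIV \<times> W \<Longrightarrow> g (case k of (\<mu>, u) \<Rightarrow> H u * Z (inv u \<mu>))
        = (case k of (\<mu>, u) \<Rightarrow> if u = w then \<tau> (inv u \<mu>) else 0)"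
    using unitriangular_functional[OF ZH_inj ZH_independent HZ_triangular,
        of "\<lambda>(\<mu>, u). if u = w then \<tau> (inv u \<mu>) else 0"] by blast
  have "g (H u * Z \<mu>) = (if u = w then \<tau> \<mu> else 0)" if "u \<in> W" for \<mu> u
  proof -
    have "inv u (u \<mu>) = \<mu>" using W_inverse(1)[OF that] by (simp add: bij_is_inj)
    moreover have "g (H u * Z (inv u (u \<mu>))) = (if u = w then \<tau> (inv u (u \<mu>)) else 0)"
      using g(3)[of "(u \<mu>, u)"] that unfolding prod.case by blast
    ultimately show ?thesis by (simp only:)
  qed
  with g(1,2) show thesis using that by blast
qed

section \<open>Weight vectors modulo a left ideal\<close>

definition left_ideal :: "'h set \<Rightarrow> bool" where
  "left_ideal L \<longleftrightarrow> subspace L \<and> (\<forall>h. \<forall>x\<in>L. h * x \<in> L)"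

lemma left_idealD:
  assumes "left_ideal L"
  shows "subspace L" "x \<in> L \<Longrightarrow> h * x \<in> L" "0 \<in> L" "x \<in> L \<Longrightarrow> y \<in> L \<Longrightarrow> x + y \<in> L"
    "x \<in> L \<Longrightarrow> y \<in> L \<Longrightarrow> x - y \<in> L" "x \<in> L \<Longrightarrow> scale c x \<in> L"
  using assms
  by (auto simp: left_ideal_def subspace_0 subspace_add subspace_diff subspace_scale)

lemma left_idealI:
  assumes "0 \<in> L" and "\<And>x y. x \<in> L \<Longrightarrow> y \<in> L \<Longrightarrow> x + y \<in> L" and "\<And>h x. x \<in> L \<Longrightarrow> h * x \<in> L"
  shows "left_ideal L"
  unfolding left_ideal_def subspace_def using assms scale_eq_mult by metis

lemma left_ideal_scale_cancel:
  "left_ideal L \<Longrightarrow> scale c x \<in> L \<Longrightarrow> c \<noteq> 0 \<Longrightarrow> x \<in> L"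
  using left_idealD(6)[of L "scale c x" "inverse c"] by simp

text \<open>Weight vectors of the quotient by \<open>L\<close>, expressed through representatives so
  that no quotient space is formed. Elements of a left ideal \<open>L\<close> have every
  weight.\<close>

definition weight :: "'h set \<Rightarrow> ('y \<Rightarrow> 'f) \<Rightarrow> 'h \<Rightarrow> bool" where
  "weight L \<chi> v \<longleftrightarrow> (\<forall>\<mu>. Z \<mu> * v - scale (\<chi> \<mu>) v \<in> L)"

lemma weight_mono: "weight L \<chi> v \<Longrightarrow> L \<subseteq> M \<Longrightarrow> weight M \<chi> v"
  unfolding weight_def by blast

lemma weight_scale: "left_ideal L \<Longrightarrow> weight L \<chi> v \<Longrightarrow> weight L \<chi> (scale c v)"
proof -
  assume L: "left_ideal L" and v: "weight L \<chi> v"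
  have "Z \<mu> * scale c v - scale (\<chi> \<mu>) (scale c v) = scale c (Z \<mu> * v - scale (\<chi> \<mu>) v)" for \<mu>
    by (simp add: scale_mult_right scale_right_diff_distrib mult.commute)
  then show ?thesis using v left_idealD(6)[OF L] by (simp add: weight_def)
qed

lemma weight_emb:
  assumes L: "left_ideal L" and v: "weight L \<chi> v"
  shows "emb p * v - scale (ga_eval \<chi> p) v \<in> L"
proof -
  have "emb p * v - scale (ga_eval \<chi> p) v
      = (\<Sum>\<mu>\<in>ga_supp p. scale (ga_coeff p \<mu>) (Z \<mu> * v - scale (\<chi> \<mu>) v))"
    by (simp add: ga_embed_def ga_eval_def sum_distrib_right scale_sum_left scale_mult_left
        scale_right_diff_distrib sum_subtractf)
  also have "\<dots> \<in> L"
    using v left_idealD[OF L] by (intro subspace_sum) (auto simp: weight_def)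
  finally show ?thesis .
qed

text \<open>Applying Z \<mu> minus the scalar of the weight of a removes the summand of a and
  rescales the others. By induction each rescaled summand is in \<open>L\<close>, and \<mu> can be
  chosen so that the factor is nonzero because the weights differ.\<close>

lemma weight_projection:
  assumes L: "left_ideal L" and "finite A" and "inj_on \<chi> A"
    and "\<And>k. k \<in> A \<Longrightarrow> weight L (\<chi> k) (v k)" and "(\<Sum>k\<in>A. v k) \<in> L" and "k \<in> A"
  shows "v k \<in> L"
  using assms(2-)
proof (induction A arbitrary: v k rule: finite_induct)
  case (insert a A)
  note LD = left_idealD[OF L]
  have in_A: "v l \<in> L" if l: "l \<in> A" for l
  proof -
    have step: "scale (\<chi> l \<mu> - \<chi> a \<mu>) (v l) \<in> L" for \<mu>
    proof -
      let ?v = "\<lambda>l. scale (\<chi> l \<mu> - \<chi> a \<mu>) (v l)"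
      let ?D = "\<lambda>l. Z \<mu> * v l - scale (\<chi> l \<mu>) (v l)"
      have D: "?D l \<in> L" if "l \<in> insert a A" for l
        using insert.prems(2)[OF that] by (simp add: weight_def)
      have "(\<Sum>l\<in>insert a A. ?v l) = Z \<mu> * (\<Sum>l\<in>insert a A. v l)
          - scale (\<chi> a \<mu>) (\<Sum>l\<in>insert a A. v l) - (\<Sum>l\<in>insert a A. ?D l)"
        by (simp add: sum_distrib_left scale_sum_right sum_subtractf scale_left_diff_distrib
            scale_right_distrib algebra_simps del: sum.insert)
      also have "\<dots> \<in> L"
        by (rule LD(5)[OF LD(5)[OF LD(2) LD(6)] subspace_sum[OF LD(1)]]) (fact insert.prems(3) D)+
      finally have "(\<Sum>l\<in>A. ?v l) \<in> L" using insert.hyps by simp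
      from insert.IH[OF _ _ this l] show ?thesis
        using insert.prems(1,2) weight_scale[OF L] by auto
    qed
    have "\<chi> l \<noteq> \<chi> a" using inj_onD[OF insert.prems(1), of l a] insert.hyps(2) l by auto
    then obtain \<mu> where "\<chi> l \<mu> - \<chi> a \<mu> \<noteq> 0" by (auto simp: fun_eq_iff)
    with step show ?thesis using left_ideal_scale_cancel[OF L] by blast
  qed
  have "v a = (\<Sum>l\<in>insert a A. v l) - (\<Sum>l\<in>A. v l)" using insert.hyps by simp
  also have "\<dots> \<in> L" by (rule LD(5)[OF insert.prems(3) subspace_sum[OF LD(1)]]) (rule in_A)
  finally show ?case using in_A insert.prems(4) by auto
qed simp

subsection \<open>Intertwiners\<close>

definition intertwiner :: "'i \<Rightarrow> ('y \<Rightarrow> 'f) \<Rightarrow> 'h \<Rightarrow> 'h" where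
  "intertwiner i \<chi> v = H (srefl i) * v - scale (Q_at i \<chi>) v"

lemma intertwiner_in_left_ideal: "left_ideal L \<Longrightarrow> v \<in> L \<Longrightarrow> intertwiner i \<chi> v \<in> L"
  unfolding intertwiner_def by (intro left_idealD)

text \<open>The relation is used at the reflected \<mu>, so that \<open>Z \<mu>\<close> stands to
  the left of \<open>H\<close>. The correction term evaluates to a multiple of
  \<open>Q_at i \<chi>\<close>, and subtracting \<open>scale (Q_at i \<chi>) v\<close> cancels
  it.\<close>

lemma weight_intertwiner:
  assumes L: "left_ideal L" and v: "weight L \<chi> v" and i: "i \<in> I"
    and \<chi>: "\<chi> \<in> torus" "\<chi> \<circ> srefl i \<noteq> \<chi>"
  shows "weight L (\<chi> \<circ> srefl i) (intertwiner i \<chi> v)"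
  unfolding weight_def
proof
  fix \<mu>
  let ?s = "srefl i" and ?q = "Q_at i \<chi>"
  note LD = left_idealD[OF L]
  obtain p where p: "to_fract p = Q_fract S \<sigma> \<sigma>' i * to_fract (ga_Z (?s \<mu>) - ga_Z (?s (?s \<mu>)))"
    "H ?s * Z (?s \<mu>) = Z (?s (?s \<mu>)) * H ?s + emb p"
    using H_mult_Z[OF i] .
  have ev: "ga_eval \<chi> p = ?q * (\<chi> (?s \<mu>) - \<chi> \<mu>)"
    using Q_at_eval[OF i \<chi> p(1)] i by simp
  have ZH: "Z \<mu> * H ?s = H ?s * Z (?s \<mu>) - emb p" using p(2) i by simp
  have w: "Z \<nu> * v - scale (\<chi> \<nu>) v \<in> L" for \<nu> using v by (simp add: weight_def)
  have "Z \<mu> * intertwiner i \<chi> v - scale ((\<chi> \<circ> ?s) \<mu>) (intertwiner i \<chi> v)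
      = H ?s * (Z (?s \<mu>) * v - scale (\<chi> (?s \<mu>)) v) - (emb p * v - scale (ga_eval \<chi> p) v)
        - scale ?q (Z \<mu> * v - scale (\<chi> \<mu>) v)"
    unfolding ev intertwiner_def
    by (simp add: algebra_simps scale_mult_right scale_right_diff_distrib scale_left_diff_distrib
        flip: mult.assoc)
       (simp add: ZH algebra_simps)
  also have "\<dots> \<in> L"
    by (rule LD(5)[OF LD(5)[OF LD(2)[OF w] weight_emb[OF L v]] LD(6)[OF w]])
  finally show "Z \<mu> * intertwiner i \<chi> v - scale ((\<chi> \<circ> ?s) \<mu>) (intertwiner i \<chi> v) \<in> L" .
qed

text \<open>With q + q' as in \<open>Q_at_refl\<close>, the terms linear in \<open>H\<close> cancel
  against \<open>H_square\<close> and leave 1 + q q'. This factors because \<sigma> (q + q') =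
  \<sigma>^2 - 1.\<close>

lemma intertwiner_intertwiner:
  assumes "i \<in> I" and "\<chi> \<in> torus" and "\<chi> \<circ> srefl i \<noteq> \<chi>"
  shows "intertwiner i (\<chi> \<circ> srefl i) (intertwiner i \<chi> v)
    = scale ((\<sigma> i - Q_at i \<chi>) * (\<sigma> i - Q_at i (\<chi> \<circ> srefl i))) v"
proof -
  let ?H = "H (srefl i)" and ?q = "Q_at i \<chi>" and ?q' = "Q_at i (\<chi> \<circ> srefl i)"
  let ?a = "\<sigma> i - inverse (\<sigma> i)"
  have q: "?q + ?q' = ?a" using assms by (rule Q_at_refl)
  have "intertwiner i (\<chi> \<circ> srefl i) (intertwiner i \<chi> v)
      = ?H * ?H * v - scale (?q + ?q') (?H * v) + scale (?q * ?q') v"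
    unfolding intertwiner_def
    by (simp add: algebra_simps scale_mult_right scale_right_diff_distrib scale_left_distrib)
  also have "\<dots> = scale (1 + ?q * ?q') v"
    unfolding q H_square[OF assms(1)]
    by (simp add: distrib_right scale_mult_left scale_left_distrib)
  also have "1 + ?q * ?q' = (\<sigma> i - ?q) * (\<sigma> i - ?q')"
  proof -
    have "\<sigma> i * (?q + ?q') = \<sigma> i * \<sigma> i - 1"
      unfolding q using sigma_nonzero[OF assms(1)] by (simp add: algebra_simps)
    then show ?thesis by (simp add: algebra_simps)
  qed
  finally show ?thesis .
qed

text \<open>The analogue of \<open>Fil\<close> in the cyclic module generated by y; the factors
  \<open>Z\<close> are absent because they act by scalars on a weight vector.\<close>

definition low :: "'h \<Rightarrow> nat \<Rightarrow> 'h set" where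
  "low y n = span ((\<lambda>w. H w * y) ` {w \<in> W. len S w < n})"

lemma low_base: "w \<in> W \<Longrightarrow> len S w < n \<Longrightarrow> H w * y \<in> low y n"
  unfolding low_def by (rule span_base) auto

lemma low_mono: "m \<le> n \<Longrightarrow> low y m \<subseteq> low y n"
  unfolding low_def by (rule span_mono) auto

lemma subspace_low [simp]: "subspace (low y n)"
  by (simp add: low_def)

lemma H_mult_low:
  assumes i: "i \<in> I" and x: "x \<in> low y n"
  shows "H (srefl i) * x \<in> low y (Suc n)"
  using x unfolding low_def
proof (rule span_mult_left[OF _ subspace_span])
  fix a assume "a \<in> (\<lambda>w. H w * y) ` {w \<in> W. len S w < n}"
  then obtain w where w: "w \<in> W" "len S w < n" "a = H w * y" by blast
  have "H (srefl i) * H w * y \<in> low y (Suc n)"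
    using len_refl_comp_cases[OF i w(1)]
  proof
    assume "len S w = len S (srefl i \<circ> w) + 1"
    then show ?thesis
      using i w H_mult_shorter
      by (auto simp: distrib_right scale_mult_left intro!: subspace_add subspace_scale low_base)
  qed (use i w H_mult_longer in \<open>auto intro!: low_base\<close>)
  then show "H (srefl i) * a \<in> span ((\<lambda>w. H w * y) ` {w \<in> W. len S w < Suc n})"
    by (simp add: low_def w(3) mult.assoc)
qed

lemma intertwiner_leading:
  assumes i: "i \<in> I" and u: "u \<in> W" and longer: "len S (srefl i \<circ> u) = len S u + 1"
    and v: "v - H u * y \<in> low y (len S u)"
  shows "intertwiner i \<chi> v - H (srefl i \<circ> u) * y \<in> low y (len S (srefl i \<circ> u))"
proof -
  have "intertwiner i \<chi> v - H (srefl i \<circ> u) * y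
      = H (srefl i) * (v - H u * y) - scale (Q_at i \<chi>) (v - H u * y) - scale (Q_at i \<chi>) (H u * y)"
    unfolding intertwiner_def H_mult_longer[OF i u longer, symmetric]
    by (simp add: right_diff_distrib scale_right_diff_distrib mult.assoc)
  also have "\<dots> \<in> low y (len S u + 1)"
  proof (rule subspace_diff[OF subspace_low subspace_diff[OF subspace_low _
          subspace_scale[OF subspace_low]] subspace_scale[OF subspace_low]])
    show "H (srefl i) * (v - H u * y) \<in> low y (len S u + 1)" using H_mult_low[OF i v] by simp
    show "v - H u * y \<in> low y (len S u + 1)" using v low_mono[of "len S u" "len S u + 1" y] by auto
    show "H u * y \<in> low y (len S u + 1)" using u by (simp add: low_base)
  qed
  finally show ?thesis using longer by simp
qed

subsection \<open>Regular characters\<close>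

text \<open>Freeness of the orbit map, in the form in which \<open>weight_projection\<close>
  consumes it; the character \<open>\<chi> \<circ> inv w\<close> is the translate of \<chi> by
  w.\<close>

definition regular :: "('y \<Rightarrow> 'f) \<Rightarrow> bool" where
  "regular \<chi> \<longleftrightarrow> \<chi> \<in> torus \<and> inj_on (\<lambda>w. \<chi> \<circ> inv w) W"

lemma inv_refl_comp: "i \<in> I \<Longrightarrow> u \<in> W \<Longrightarrow> inv (srefl i \<circ> u) = inv u \<circ> srefl i"
  by (simp add: o_inv_distrib W_inverse)

lemma regularI:
  assumes "\<chi> \<in> torus" and "\<forall>w\<in>W - {id}. torus_act w \<chi> \<noteq> \<chi>"
  shows "regular \<chi>"
  unfolding regular_def
proof (intro conjI inj_onI)
  fix u w assume u: "u \<in> W" and w: "w \<in> W" and eq: "\<chi> \<circ> inv u = \<chi> \<circ> inv w"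
  let ?x = "inv w \<circ> u"
  have x: "?x \<in> W" using u w by (simp add: W_comp W_inverse)
  have "inv ?x = inv u \<circ> w"
    using u w by (simp add: o_inv_distrib W_inverse bij_imp_bij_inv inv_inv_eq)
  then have "torus_act ?x \<chi> = \<chi> \<circ> inv w \<circ> w" by (simp add: torus_act_eq eq flip: comp_assoc)
  also have "\<dots> = \<chi>" using W_inverse(1)[OF w] by (simp add: comp_assoc bij_is_inj)
  finally have "?x = id" using assms(2) x by blast
  then have "w \<circ> inv w \<circ> u = w" by (simp add: comp_assoc)
  moreover have "w \<circ> inv w = id" using W_inverse(1)[OF w] by (simp add: bij_is_surj flip: surj_iff)
  ultimately show "u = w" by simp
qed (use assms in simp)

lemma regular_comp_inv:
  assumes "regular \<chi>" and w: "w \<in> W"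
  shows "regular (\<chi> \<circ> inv w)"
  unfolding regular_def
proof (intro conjI inj_onI)
  show "\<chi> \<circ> inv w \<in> torus" using assms by (simp add: regular_def torus_comp_W W_inverse)
  fix u u' assume u: "u \<in> W" "u' \<in> W" and eq: "\<chi> \<circ> inv w \<circ> inv u = \<chi> \<circ> inv w \<circ> inv u'"
  have "\<chi> \<circ> inv w \<circ> inv u = \<chi> \<circ> inv (u \<circ> w)" if "u \<in> W" for u
    using that w by (simp add: o_inv_distrib W_inverse comp_assoc)
  with eq u have "\<chi> \<circ> inv (u \<circ> w) = \<chi> \<circ> inv (u' \<circ> w)" by simp
  then have "u \<circ> w = u' \<circ> w" using assms u by (auto simp: regular_def W_comp dest: inj_onD)
  then show "u = u'" using W_inverse(1)[OF w]
    by (metis bij_is_surj surj_iff comp_assoc comp_id)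
qed

lemma regular_refl:
  assumes "regular \<chi>" and "i \<in> I"
  shows "\<chi> \<in> torus" and "\<chi> \<circ> srefl i \<noteq> \<chi>" and "regular (\<chi> \<circ> srefl i)"
proof -
  show "\<chi> \<in> torus" using assms by (simp add: regular_def)
  show "regular (\<chi> \<circ> srefl i)" using regular_comp_inv[OF assms(1) refl_in_W[OF assms(2)]] assms by simp
  show "\<chi> \<circ> srefl i \<noteq> \<chi>"
  proof
    assume "\<chi> \<circ> srefl i = \<chi>"
    then have "\<chi> \<circ> inv (srefl i) = \<chi> \<circ> inv id" using assms by simp
    then have "srefl i = id"
      using assms by (auto simp: regular_def dest: inj_onD[of _ W "srefl i" id])
    then show False using len_refl[OF assms(2)] by simp
  qed
qed

text \<open>For the third property the opposite intertwiner undoes the last step up to a nonzero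
  scalar, and one descends to y. The generality in y serves two uses: y = 1 modulo
  \<open>J \<tau>\<close>, and the generator of the proper submodule in
  \<open>J_not_maximal\<close>.\<close>

lemma ex_weight_vectors:
  assumes L: "left_ideal L" and \<chi>: "regular \<chi>" and y: "weight L \<chi> y"
  obtains v where "\<And>w. w \<in> W \<Longrightarrow> weight L (\<chi> \<circ> inv w) (v w)"
    "\<And>w. w \<in> W \<Longrightarrow> v w - H w * y \<in> low y (len S w)"
    "\<And>w M. w \<in> W \<Longrightarrow> \<forall>u\<in>W. \<forall>i\<in>I. Q_at i (\<chi> \<circ> inv u) \<noteq> \<sigma> i \<Longrightarrow> left_ideal M \<Longrightarrow> v w \<in> M \<Longrightarrow> y \<in> M"
proof -
  let ?P = "\<lambda>w v. weight L (\<chi> \<circ> inv w) v \<and> v - H w * y \<in> low y (len S w) \<and>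
    ((\<forall>u\<in>W. \<forall>i\<in>I. Q_at i (\<chi> \<circ> inv u) \<noteq> \<sigma> i) \<longrightarrow> (\<forall>M. left_ideal M \<and> v \<in> M \<longrightarrow> y \<in> M))"
  have "\<exists>v. ?P w v" if "w \<in> W" for w
    using that
  proof (induction "len S w" arbitrary: w rule: less_induct)
    case less
    show ?case
    proof (cases "w = id")
      case True
      then show ?thesis using y by (intro exI[of _ y]) (simp add: Z_zero subspace_0)
    next
      case False
      obtain i u where u: "i \<in> I" "u \<in> W" "w = srefl i \<circ> u" "len S w = len S u + 1"
        using W_cases_len[OF less.prems False] .
      then obtain v where v: "?P u v" using less.hyps[of u] by auto
      let ?\<chi> = "\<chi> \<circ> inv u"
      have w: "\<chi> \<circ> inv w = ?\<chi> \<circ> srefl i" using u by (simp add: inv_refl_comp comp_assoc)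
      note reg = regular_refl[OF regular_comp_inv[OF \<chi> u(2)] u(1)]
      have "y \<in> M" if *: "\<forall>u\<in>W. \<forall>i\<in>I. Q_at i (\<chi> \<circ> inv u) \<noteq> \<sigma> i"
        and M: "left_ideal M" "intertwiner i ?\<chi> v \<in> M" for M
      proof -
        have "intertwiner i (?\<chi> \<circ> srefl i) (intertwiner i ?\<chi> v) \<in> M"
          using M by (rule intertwiner_in_left_ideal)
        then have "scale ((\<sigma> i - Q_at i ?\<chi>) * (\<sigma> i - Q_at i (\<chi> \<circ> inv w))) v \<in> M"
          unfolding intertwiner_intertwiner[OF u(1) reg(1,2)] w .
        moreover have "Q_at i ?\<chi> \<noteq> \<sigma> i" "Q_at i (\<chi> \<circ> inv w) \<noteq> \<sigma> i" using * u less.prems by auto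
        ultimately have "v \<in> M" using left_ideal_scale_cancel[OF M(1)] by simp
        then show ?thesis using v * M(1) by blast
      qed
      moreover have "weight L (\<chi> \<circ> inv w) (intertwiner i ?\<chi> v)"
        unfolding w using L v u(1) reg(1,2) by (intro weight_intertwiner) auto
      moreover have "intertwiner i ?\<chi> v - H w * y \<in> low y (len S w)"
        using intertwiner_leading[OF u(1,2), of v y ?\<chi>] u v by simp
      ultimately show ?thesis by blast
    qed
  qed
  then have "\<exists>v. \<forall>w\<in>W. ?P w (v w)" by (intro bchoice) blast
  then show thesis using that by blast
qed

text \<open>\<open>H w * Z \<mu>\<close> acts on y like a multiple of \<open>H w\<close> modulo
  \<open>L\<close>, and triangularity expresses \<open>H w * y\<close> through v. Only the shape of
  v is prescribed, not its weights, so a member may later be replaced by 0.\<close>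

lemma weight_vectors_span:
  assumes L: "left_ideal L" and y: "weight L \<chi> y"
    and v: "\<And>w. w \<in> W \<Longrightarrow> v w - H w * y \<in> low y (len S w)"
  obtains A c where "finite A" "A \<subseteq> W" "h * y - (\<Sum>w\<in>A. scale (c w) (v w)) \<in> L"
proof -
  note LD = left_idealD[OF L]
  have Hy: "H w * y \<in> span (v ` W)" if "w \<in> W" for w
    by (rule unitriangular_span[where b = "\<lambda>w. H w * y" and rank = "len S"])
       (use v that in \<open>auto simp: low_def\<close>)
  let ?P = "\<lambda>h. \<exists>x\<in>span (v ` W). h * y - x \<in> L"
  have "subspace {h. ?P h}"
  proof (rule subspaceI)
    show "0 \<in> {h. ?P h}" using LD(3) by (auto intro!: bexI[of _ 0] span_zero)
  next
    fix h h' assume "h \<in> {h. ?P h}" "h' \<in> {h. ?P h}"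
    then obtain x x' where x: "x \<in> span (v ` W)" "h * y - x \<in> L" "x' \<in> span (v ` W)" "h' * y - x' \<in> L"
      by blast
    have "(h + h') * y - (x + x') = (h * y - x) + (h' * y - x')" by (simp add: algebra_simps)
    then have "(h + h') * y - (x + x') \<in> L" using x LD(4) by (simp only:)
    then show "h + h' \<in> {h. ?P h}" using x span_add by blast
  next
    fix c h assume "h \<in> {h. ?P h}"
    then obtain x where x: "x \<in> span (v ` W)" "h * y - x \<in> L" by blast
    have "scale c h * y - scale c x = scale c (h * y - x)"
      by (simp add: scale_mult_left scale_right_diff_distrib)
    then have "scale c h * y - scale c x \<in> L" using x LD(6) by (simp only:)
    then show "scale c h \<in> {h. ?P h}" using x span_scale by blast
  qed
  moreover have "h \<in> span ((\<lambda>(\<mu>, w). H w * Z \<mu>) ` (UNIV \<times> W))" using HZ_span by simp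
  moreover have "?P a" if a_in: "a \<in> (\<lambda>(\<mu>, w). H w * Z \<mu>) ` (UNIV \<times> W)" for a
  proof -
    obtain \<mu> w where a: "a = H w * Z \<mu>" "w \<in> W" using a_in by auto
    have "a * y - scale (\<chi> \<mu>) (H w * y) = H w * (Z \<mu> * y - scale (\<chi> \<mu>) y)"
      by (simp add: a(1) right_diff_distrib scale_mult_right mult.assoc)
    also have "\<dots> \<in> L" using y LD(2) by (simp add: weight_def)
    finally show ?thesis using Hy[OF a(2)] span_scale by blast
  qed
  ultimately have "?P h" using span_induct[of h _ ?P] by blast
  then show thesis using in_span_image_sum that by metis
qed

section \<open>The annihilator of the generating vector\<close>

definition J :: "('y \<Rightarrow> 'f) \<Rightarrow> 'h set" where
  "J \<tau> = span {h * (Z \<mu> - scale (\<tau> \<mu>) 1) | h \<mu>. True}"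

lemma left_ideal_J: "left_ideal (J \<tau>)"
proof -
  have "h * x \<in> J \<tau>" if "x \<in> J \<tau>" for h x
    using that unfolding J_def
  proof (rule span_mult_left)
    fix a assume "a \<in> {h * (Z \<mu> - scale (\<tau> \<mu>) 1) | h \<mu>. True}"
    then obtain h' \<mu> where "a = h' * (Z \<mu> - scale (\<tau> \<mu>) 1)" by blast
    then have "h * a = (h * h') * (Z \<mu> - scale (\<tau> \<mu>) 1)" by (simp add: mult.assoc)
    then show "h * a \<in> span {h * (Z \<mu> - scale (\<tau> \<mu>) 1) | h \<mu>. True}"
      by (intro span_base) blast
  qed simp
  then show ?thesis by (auto simp: left_ideal_def J_def)
qed

lemma weight_J_one: "weight (J \<tau>) \<tau> 1"
  unfolding weight_def J_def
proof
  fix \<mu>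
  have "Z \<mu> * 1 - scale (\<tau> \<mu>) 1 = 1 * (Z \<mu> - scale (\<tau> \<mu>) 1)" by simp
  then show "Z \<mu> * 1 - scale (\<tau> \<mu>) 1 \<in> span {h * (Z \<mu> - scale (\<tau> \<mu>) 1) | h \<mu>. True}"
    by (intro span_base) blast
qed

text \<open>The functional g turns right multiplication by \<open>Z \<mu>\<close> into the scalar
  \<tau> \<mu>, so it kills \<open>J \<tau>\<close>. It also kills every shorter \<open>H u\<close>,
  but is 1 on \<open>H w\<close>.\<close>

lemma leading_notin_J:
  assumes \<tau>: "\<tau> \<in> torus" and w: "w \<in> W" and v: "v - H w * 1 \<in> low 1 (len S w)"
  shows "v \<notin> J \<tau>"
proof
  assume v_J: "v \<in> J \<tau>"
  obtain g where g: "\<And>x y. g (x + y) = g x + g y" "\<And>c x. g (scale c x) = c * g x"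
    "\<And>\<mu> u. u \<in> W \<Longrightarrow> g (H u * Z \<mu>) = (if u = w then \<tau> \<mu> else 0)"
    using HZ_functional[OF w, of \<tau>] by blast
  have g0: "g 0 = 0" using g(1)[of 0 0] by simp
  have gd: "g (x - y) = g x - g y" for x y using g(1)[of "x - y" y] by simp
  have ker: "subspace {x. g x = 0}" by (auto simp: subspace_def g g0)
  have gZ: "g (h * Z \<mu>) = \<tau> \<mu> * g h" for h \<mu>
  proof -
    have "subspace {h. g (h * Z \<mu>) = \<tau> \<mu> * g h}"
      by (auto simp: subspace_def g g0 distrib_right distrib_left scale_mult_left)
    moreover have "g (a * Z \<mu>) = \<tau> \<mu> * g a"
      if a_in: "a \<in> (\<lambda>(\<mu>, w). H w * Z \<mu>) ` (UNIV \<times> W)" for a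
    proof -
      obtain \<nu> u where "a = H u * Z \<nu>" "u \<in> W" using a_in by auto
      then show ?thesis using g(3) \<tau> by (simp add: mult.assoc Z_mult_Z torus_add)
    qed
    moreover have "h \<in> span ((\<lambda>(\<mu>, w). H w * Z \<mu>) ` (UNIV \<times> W))" using HZ_span by simp
    ultimately show ?thesis
      using span_induct[of h _ "\<lambda>h. g (h * Z \<mu>) = \<tau> \<mu> * g h"] by blast
  qed
  have "J \<tau> \<subseteq> {x. g x = 0}"
    unfolding J_def
    by (rule span_minimal[OF _ ker]) (auto simp: right_diff_distrib gd gZ g scale_mult_right)
  then have "g v = 0" using v_J by blast
  have gH: "g (H u) = (if u = w then 1 else 0)" if "u \<in> W" for u
    using g(3)[OF that, of 0] \<tau> by (simp add: Z_zero)
  have "low 1 (len S w) \<subseteq> {x. g x = 0}"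
    unfolding low_def by (rule span_minimal[OF _ ker]) (auto simp: gH)
  then have "g (v - H w * 1) = 0" using v by blast
  then have "g v = 1" using gH[OF w] by (simp add: gd)
  with \<open>g v = 0\<close> show False by simp
qed

lemma J_maximal:
  assumes \<tau>: "regular \<tau>" and Q: "\<forall>u\<in>W. \<forall>i\<in>I. Q_at i (\<tau> \<circ> inv u) \<noteq> \<sigma> i"
    and M: "left_ideal M" "J \<tau> \<subseteq> M" "M \<noteq> J \<tau>"
  shows "M = UNIV"
proof -
  note JD = left_idealD[OF left_ideal_J[of \<tau>]]
  obtain v where v: "\<And>w. w \<in> W \<Longrightarrow> weight (J \<tau>) (\<tau> \<circ> inv w) (v w)"
    "\<And>w. w \<in> W \<Longrightarrow> v w - H w * 1 \<in> low 1 (len S w)"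
    "\<And>w. w \<in> W \<Longrightarrow> v w \<in> M \<Longrightarrow> 1 \<in> M"
    using ex_weight_vectors[OF left_ideal_J \<tau> weight_J_one] Q M(1) by metis
  obtain h where h: "h \<in> M" "h \<notin> J \<tau>" using M by blast
  obtain A c where A: "finite A" "A \<subseteq> W" "h * 1 - (\<Sum>w\<in>A. scale (c w) (v w)) \<in> J \<tau>"
    using weight_vectors_span[OF left_ideal_J weight_J_one v(2)] .
  let ?x = "\<Sum>w\<in>A. scale (c w) (v w)"
  have "h - (h * 1 - ?x) \<in> M" using left_idealD(5)[OF M(1) h(1) subsetD[OF M(2) A(3)]] .
  then have x: "?x \<in> M" by simp
  \<comment> \<open>Weights modulo \<open>J \<tau>\<close> remain weights modulo the larger
    \<open>M\<close>, so the projection can be carried out inside \<open>M\<close>.\<close>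
  have cv: "scale (c w) (v w) \<in> M" if "w \<in> A" for w
  proof (rule weight_projection[OF M(1) A(1) _ _ x that])
    show "inj_on (\<lambda>w. \<tau> \<circ> inv w) A" using \<tau> A(2) by (auto simp: regular_def intro: inj_on_subset)
    show "weight M (\<tau> \<circ> inv w) (scale (c w) (v w))" if "w \<in> A" for w
      using weight_scale[OF M(1) weight_mono[OF v(1) M(2)]] that A(2) by blast
  qed
  have "\<exists>w\<in>A. c w \<noteq> 0"
  proof (rule ccontr)
    assume "\<not> (\<exists>w\<in>A. c w \<noteq> 0)"
    then have "?x = 0" by simp
    with A(3) h(2) show False by simp
  qed
  then obtain w where w: "w \<in> A" "c w \<noteq> 0" by blast
  then have "v w \<in> M" using cv left_ideal_scale_cancel[OF M(1)] by blast
  then have "1 \<in> M" using v(3) w A(2) by blast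
  then have "h * 1 \<in> M" for h using left_idealD(2)[OF M(1)] by blast
  then show ?thesis by auto
qed

text \<open>If \<open>Q_at i \<chi> = \<sigma> i\<close> for the weight \<open>\<chi> = w.\<tau>\<close>, the intertwiner carries the vector \<open>v\<close> of weight
  \<open>\<chi>\<close> to a vector \<open>y\<close> that is killed by the opposite intertwiner; the weight \<open>\<chi>\<close> then does not
  occur in the submodule that \<open>y\<close> generates.\<close>

lemma J_not_maximal:
  assumes \<tau>: "regular \<tau>" and u: "u \<in> W" "i \<in> I" "Q_at i (\<tau> \<circ> inv u) = \<sigma> i"
  obtains M where "left_ideal M" "J \<tau> \<subseteq> M" "M \<noteq> J \<tau>" "M \<noteq> UNIV"
proof -
  note LJ = left_ideal_J[of \<tau>]
  note JD = left_idealD[OF LJ]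
  \<comment> \<open>The product is symmetric in the two characters, so u may be exchanged for its
    reflection. The longer reflected element is what gives both v and y a leading term.\<close>
  have "\<exists>w\<in>W. len S (srefl i \<circ> w) = len S w + 1 \<and>
    (\<sigma> i - Q_at i (\<tau> \<circ> inv w)) * (\<sigma> i - Q_at i (\<tau> \<circ> inv w \<circ> srefl i)) = 0"
    using len_refl_comp_cases[OF u(2,1)]
  proof
    assume "len S u = len S (srefl i \<circ> u) + 1"
    moreover have "\<tau> \<circ> inv (srefl i \<circ> u) \<circ> srefl i = \<tau> \<circ> inv u"
      using u by (auto simp: inv_refl_comp fun_eq_iff)
    ultimately show ?thesis using u by (intro bexI[of _ "srefl i \<circ> u"]) simp_all
  qed (use u in auto)
  then obtain w where w: "w \<in> W" "len S (srefl i \<circ> w) = len S w + 1"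
    and zero: "(\<sigma> i - Q_at i (\<tau> \<circ> inv w)) * (\<sigma> i - Q_at i (\<tau> \<circ> inv w \<circ> srefl i)) = 0"
    by blast
  define \<chi> where "\<chi> = \<tau> \<circ> inv w"
  note zero = zero[folded \<chi>_def]
  note reg = regular_refl[OF regular_comp_inv[OF \<tau> w(1), folded \<chi>_def] u(2)]
  obtain v where v: "weight (J \<tau>) \<chi> v" "v - H w * 1 \<in> low 1 (len S w)"
    using ex_weight_vectors[OF LJ \<tau> weight_J_one] w(1) unfolding \<chi>_def by metis
  define y where "y = intertwiner i \<chi> v"
  have y_weight: "weight (J \<tau>) (\<chi> \<circ> srefl i) y"
    unfolding y_def using LJ v(1) u(2) reg(1,2) by (rule weight_intertwiner)
  have kill: "intertwiner i (\<chi> \<circ> srefl i) y = 0"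
    unfolding y_def intertwiner_intertwiner[OF u(2) reg(1,2)] zero by simp
  have \<tau>_torus: "\<tau> \<in> torus" using \<tau> by (simp add: regular_def)
  have v_notin: "v \<notin> J \<tau>" using leading_notin_J[OF \<tau>_torus w(1) v(2)] .
  have y_notin: "y \<notin> J \<tau>"
    using leading_notin_J[OF \<tau>_torus refl_comp_in_W[OF u(2) w(1)]
        intertwiner_leading[OF u(2) w v(2), of \<chi>]] by (simp add: y_def)
  define M where "M = {h * y + x | h x. x \<in> J \<tau>}"
  have "left_ideal M"
  proof (rule left_idealI)
    show "0 \<in> M" unfolding M_def using JD(3) by (auto intro!: exI[of _ 0])
  next
    fix a b assume "a \<in> M" "b \<in> M"
    then obtain h x h' x' where "a = h * y + x" "b = h' * y + x'" "x \<in> J \<tau>" "x' \<in> J \<tau>"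
      unfolding M_def by blast
    then have "a + b = (h + h') * y + (x + x')" "x + x' \<in> J \<tau>"
      using JD(4) by (simp_all add: algebra_simps)
    then show "a + b \<in> M" unfolding M_def by blast
  next
    fix g a assume "a \<in> M"
    then obtain h x where "a = h * y + x" "x \<in> J \<tau>" unfolding M_def by blast
    then have "g * a = (g * h) * y + g * x" "g * x \<in> J \<tau>"
      using JD(2) by (simp_all add: algebra_simps)
    then show "g * a \<in> M" unfolding M_def by blast
  qed
  moreover have "J \<tau> \<subseteq> M"
  proof
    fix x assume "x \<in> J \<tau>"
    moreover have "x = 0 * y + x" by simp
    ultimately show "x \<in> M" unfolding M_def by blast
  qed
  moreover have "y \<in> M"
  proof -
    have "y = 1 * y + 0" by simp
    then show ?thesis unfolding M_def using JD(3) by blast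
  qed
  moreover have "v \<notin> M"
  proof
    assume "v \<in> M"
    then obtain h x where h: "v = h * y + x" "x \<in> J \<tau>" unfolding M_def by blast
    obtain z where z: "\<And>w. w \<in> W \<Longrightarrow> weight (J \<tau>) (\<chi> \<circ> srefl i \<circ> inv w) (z w)"
      "\<And>w. w \<in> W \<Longrightarrow> z w - H w * y \<in> low y (len S w)"
      using ex_weight_vectors[OF LJ reg(3) y_weight] by metis
    \<comment> \<open>The member at \<open>srefl i\<close> would carry the weight \<chi> of v. By
      \<open>kill\<close>, \<open>H (srefl i) * y\<close> is a multiple of y, hence of lower length,
      so 0 is also admissible there.\<close>
    define z' where "z' = z(srefl i := 0)"
    have z': "z' w - H w * y \<in> low y (len S w)" if "w \<in> W" for w
    proof (cases "w = srefl i")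
      case True
      have "scale (Q_at i (\<chi> \<circ> srefl i)) (H id * y) \<in> low y 1"
        by (intro subspace_scale low_base) simp_all
      moreover have "H (srefl i) * y = scale (Q_at i (\<chi> \<circ> srefl i)) (H id * y)"
        using kill by (simp add: intertwiner_def Z_zero)
      ultimately show ?thesis
        using True u(2) subspace_neg[OF subspace_low] by (simp add: z'_def)
    qed (use z(2) that in \<open>simp add: z'_def\<close>)
    obtain A c where A: "finite A" "A \<subseteq> W" "h * y - (\<Sum>w\<in>A. scale (c w) (z' w)) \<in> J \<tau>"
      using weight_vectors_span[OF LJ y_weight z'] .
    let ?B = "A - {srefl i}"
    \<comment> \<open>v takes the vacant place of weight \<chi>. The negative signs turn v = h y + x
      into a sum of vectors of distinct weights that lies in \<open>J \<tau>\<close>.\<close>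
    define t where "t w = (if w = srefl i then v else scale (- c w) (z w))" for w
    have "(\<Sum>w\<in>A. scale (c w) (z' w)) = (\<Sum>w\<in>?B. scale (c w) (z w))"
      using A(1) by (intro sum.mono_neutral_cong_right) (auto simp: z'_def)
    moreover have "(\<Sum>w\<in>insert (srefl i) ?B. t w) = v + (\<Sum>w\<in>?B. t w)"
      using A(1) by (subst sum.insert) (auto simp: t_def)
    moreover have "(\<Sum>w\<in>?B. t w) = - (\<Sum>w\<in>?B. scale (c w) (z w))"
      unfolding sum_negf[symmetric] by (rule sum.cong) (auto simp: t_def)
    ultimately have "(\<Sum>w\<in>insert (srefl i) ?B. t w) = (h * y - (\<Sum>w\<in>A. scale (c w) (z' w))) + x"
      using h(1) by simp
    also have "\<dots> \<in> J \<tau>" using A(3) h(2) by (rule JD(4))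
    finally have "(\<Sum>w\<in>insert (srefl i) ?B. t w) \<in> J \<tau>" .
    then have "t (srefl i) \<in> J \<tau>"
    proof (rule weight_projection[OF LJ, rotated 3])
      show "inj_on (\<lambda>w. \<chi> \<circ> srefl i \<circ> inv w) (insert (srefl i) ?B)"
        using reg(3) A(2) u(2) unfolding regular_def by (elim conjE inj_on_subset) auto
      fix w assume w: "w \<in> insert (srefl i) ?B"
      show "weight (J \<tau>) (\<chi> \<circ> srefl i \<circ> inv w) (t w)"
      proof (cases "w = srefl i")
        case True
        have "\<chi> \<circ> srefl i \<circ> inv w = \<chi>" unfolding True using u(2) by (simp add: fun_eq_iff)
        then show ?thesis using v(1) True by (simp add: t_def)
      next
        case False
        then have "w \<in> W" using w A(2) by auto
        then show ?thesis
          unfolding t_def if_not_P[OF False] using weight_scale[OF LJ z(1)] by blast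
      qed
    qed (use A(1) in auto)
    with v_notin show False by (simp add: t_def)
  qed
  ultimately show thesis using that[of M] y_notin by blast
qed

end

section \<open>The principal series as a quotient by a left ideal\<close>

context BL_hecke
begin

context
  fixes \<tau> :: "'y \<Rightarrow> 'f"
  assumes \<tau>: "\<tau> \<in> torus"
begin

abbreviation "ract h p \<equiv> h * emb p"
abbreviation "lact p c \<equiv> ga_eval \<tau> p * (c :: 'f)"
abbreviation "null \<equiv> tensor_null ract lact"

text \<open>The map induced by \<open>h \<otimes> c \<mapsto> c h\<close>.\<close>

definition contract :: "('h \<times> 'f \<Rightarrow>\<^sub>0 int) \<Rightarrow> 'h" where
  "contract x = (\<Sum>k\<in>Poly_Mapping.keys x. of_int (Poly_Mapping.lookup x k) * scale (snd k) (fst k))"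

lemma contract_superset:
  assumes "finite A" and "Poly_Mapping.keys x \<subseteq> A"
  shows "contract x = (\<Sum>k\<in>A. of_int (Poly_Mapping.lookup x k) * scale (snd k) (fst k))"
  unfolding contract_def using assms by (intro sum.mono_neutral_left) (auto simp: in_keys_iff)

lemma contract_diff: "contract (x - y) = contract x - contract y"
proof -
  let ?A = "Poly_Mapping.keys x \<union> Poly_Mapping.keys y"
  have "Poly_Mapping.keys (x - y) \<subseteq> ?A" by (auto simp: in_keys_iff lookup_minus)
  then show ?thesis
    using contract_superset[of ?A x] contract_superset[of ?A y] contract_superset[of ?A "x - y"]
    by (simp add: lookup_minus left_diff_distrib sum_subtractf)
qed

lemma contract_zero [simp]: "contract 0 = 0"
  by (simp add: contract_def)

lemma contract_add: "contract (x + y) = contract x + contract y"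
  using contract_diff[of "x + y" y] by simp

lemma contract_frag_of [simp]: "contract (frag_of (h, c)) = scale c h"
  by (simp add: contract_def)

lemma null_imp_J: "x \<in> null \<Longrightarrow> contract x \<in> J \<tau>"
proof (induction rule: tensor_null.induct)
  case (balanced h p c)
  have "contract (frag_of (ract h p, c) - frag_of (h, lact p c))
      = scale c (h * (emb p * 1 - scale (ga_eval \<tau> p) 1))"
    by (simp add: contract_diff right_diff_distrib scale_mult_right scale_right_diff_distrib mult.commute)
  also have "\<dots> \<in> J \<tau>"
    by (rule left_idealD(6)[OF left_ideal_J
          left_idealD(2)[OF left_ideal_J weight_emb[OF left_ideal_J weight_J_one]]])
  finally show ?case .
qed (simp_all add: contract_diff scale_right_distrib scale_left_distrib left_idealD[OF left_ideal_J])

lemmas null_zero = tensor_null.zero[of ract lact]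
  and null_diff = tensor_null.diff[of _ ract lact]

lemma null_minus: "x \<in> null \<Longrightarrow> - x \<in> null"
  using null_diff[OF null_zero] by simp

lemma null_add: "x \<in> null \<Longrightarrow> y \<in> null \<Longrightarrow> x + y \<in> null"
  using null_diff[OF _ null_minus] by simp

lemma ga_embed_const: "emb (ga_const c) = scale c 1"
proof (cases "c = 0")
  case False
  then have "ga_supp (ga_const c :: ('y, 'f) group_algebra) = {0}" by (auto simp: ga_supp_eq ga_coeff_const)
  then show ?thesis by (simp add: ga_embed_def ga_coeff_const Z_zero)
qed (simp add: ga_embed_def ga_supp_eq)

lemma ga_embed_Z: "emb (ga_Z \<mu>) = Z \<mu>"
proof -
  have "ga_supp (ga_Z \<mu> :: ('y, 'f) group_algebra) = {\<mu>}" by (auto simp: ga_supp_eq ga_coeff_Z)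
  then show ?thesis by (simp add: ga_embed_def ga_coeff_Z)
qed

lemma null_scalar: "frag_of (scale c h, 1) - frag_of (h, c) \<in> null"
  using tensor_null.balanced[of ract h "ga_const c" 1 lact]
  by (simp add: ga_embed_const ga_eval_hom[OF \<tau>] scale_mult_right)

lemma null_frag_diff: "frag_of (h - h', c) - (frag_of (h, c) - frag_of (h', c)) \<in> null"
proof -
  have "frag_of (h - h' + h', c) - frag_of (h - h', c) - frag_of (h', c) \<in> null"
    by (rule tensor_null.add_left)
  from null_minus[OF this] show ?thesis by (simp add: algebra_simps)
qed

text \<open>Every tensor is congruent to h \<otimes> 1 with h its contraction, since scalars move to
  the left factor. This leaves only elements of the form h \<otimes> 1 to be compared with
  \<open>J \<tau>\<close>.\<close>

lemma null_contract: "x - frag_of (contract x, 1) \<in> null"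
  using subset_UNIV[of "Poly_Mapping.keys x"]
proof (induction x rule: frag_induction)
  case zero
  have "frag_of (0 + 0, 1) - frag_of (0, 1) - frag_of (0, 1) \<in> null"
    by (rule tensor_null.add_left)
  then show ?case by simp
next
  case (one k)
  show ?case using null_minus[OF null_scalar[of "snd k" "fst k"]] by (cases k) simp
next
  case (diff x y)
  from null_diff[OF null_diff[OF diff] null_frag_diff[of "contract x" "contract y" 1]]
  show ?case by (simp add: contract_diff algebra_simps)
qed

lemma J_imp_null: "x \<in> J \<tau> \<Longrightarrow> frag_of (x, 1) \<in> null"
  unfolding J_def
proof (induction rule: span_induct_alt)
  case base
  show ?case using null_contract[of 0] null_minus by fastforce
next
  case (step c x y)
  then obtain h \<mu> where x: "x = h * (Z \<mu> - scale (\<tau> \<mu>) 1)" by blast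
  let ?h = "scale c h"
  have sx: "scale c x = ?h * Z \<mu> - scale (\<tau> \<mu>) ?h"
    by (simp add: x right_diff_distrib scale_mult_left scale_mult_right scale_right_diff_distrib mult.commute)
  have "frag_of (?h * Z \<mu>, 1) - frag_of (?h, \<tau> \<mu>) \<in> null"
    using tensor_null.balanced[of ract ?h "ga_Z \<mu>" 1 lact]
    by (simp add: ga_embed_Z ga_eval_hom[OF \<tau>])
  from null_add[OF null_diff[OF this null_scalar[of "\<tau> \<mu>" ?h]]
      null_frag_diff[of "?h * Z \<mu>" "scale (\<tau> \<mu>) ?h" 1]]
  have "frag_of (scale c x, 1) \<in> null" by (simp add: sx)
  moreover have "frag_of (scale c x + y, 1) - frag_of (scale c x, 1) - frag_of (y, 1) \<in> null"
    by (rule tensor_null.add_left)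
  ultimately show ?case using null_add[OF null_add] step(2) by fastforce
qed

lemma null_iff: "x \<in> null \<longleftrightarrow> contract x \<in> J \<tau>"
proof
  assume "contract x \<in> J \<tau>"
  from null_add[OF null_contract[of x] J_imp_null[OF this]] show "x \<in> null" by simp
qed (rule null_imp_J)

text \<open>The coset of tensors that corresponds to the class of h modulo \<open>J \<tau>\<close>;
  it lets the operations of the tensor product be computed on elements of the algebra.\<close>

definition residue :: "'h \<Rightarrow> ('h \<times> 'f \<Rightarrow>\<^sub>0 int) set" where
  "residue h = {x. contract x - h \<in> J \<tau>}"

lemma tensor_coset_eq: "tensor_coset ract lact x = residue (contract x)"
proof (intro Set.set_eqI iffI)
  fix y assume "y \<in> residue (contract x)"
  then have "y - x \<in> null" by (simp add: residue_def null_iff contract_diff)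
  moreover have "y = x + (y - x)" by simp
  ultimately show "y \<in> tensor_coset ract lact x" unfolding tensor_coset_def by blast
qed (auto simp: tensor_coset_def residue_def null_iff contract_add)

lemma residue_eq_iff: "residue a = residue b \<longleftrightarrow> a - b \<in> J \<tau>"
proof
  assume "residue a = residue b"
  moreover have "frag_of (a, 1) \<in> residue a"
    by (simp add: residue_def left_idealD[OF left_ideal_J])
  ultimately show "a - b \<in> J \<tau>" by (simp add: residue_def)
next
  assume ab: "a - b \<in> J \<tau>"
  have "x - a \<in> J \<tau> \<longleftrightarrow> x - b \<in> J \<tau>" for x
    using left_idealD(4)[OF left_ideal_J, of "x - a" \<tau> "a - b"]
      left_idealD(5)[OF left_ideal_J, of "x - b" \<tau> "a - b"] ab by auto
  then show "residue a = residue b" by (simp add: residue_def)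
qed

lemma contract_extend: "contract (frag_extend (\<lambda>(m, n). frag_of (h * m, n)) x) = h * contract x"
  using subset_UNIV[of "Poly_Mapping.keys x"]
  by (induction x rule: frag_induction)
     (auto simp: frag_extend_diff contract_diff right_diff_distrib scale_mult_right)

abbreviation "P \<equiv> principal_series scale ZH \<tau>"

lemma P_carrier: "lm_carrier P = range residue"
proof -
  have "range (tensor_coset ract lact) = range residue"
  proof (intro equalityI image_subsetI)
    show "residue h \<in> range (tensor_coset ract lact)" for h
      using tensor_coset_eq[of "frag_of (h, 1)"] by (intro range_eqI[of _ _ "frag_of (h, 1)"]) simp
  qed (simp add: tensor_coset_eq)
  then show ?thesis by (simp add: principal_series_def extension_of_scalars_def)
qed

lemma P_zero: "lm_zero P = residue 0"
  by (simp add: principal_series_def extension_of_scalars_def tensor_coset_eq)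

lemma P_add: "lm_add P (residue a) (residue b) = residue (a + b)"
proof -
  have "{x + y | x y. x \<in> residue a \<and> y \<in> residue b} = residue (a + b)"
  proof (intro Set.set_eqI iffI)
    fix z assume "z \<in> {x + y | x y. x \<in> residue a \<and> y \<in> residue b}"
    then obtain x y where z: "z = x + y" "contract x - a \<in> J \<tau>" "contract y - b \<in> J \<tau>"
      by (auto simp: residue_def)
    have "contract z - (a + b) = (contract x - a) + (contract y - b)" by (simp add: z(1) contract_add)
    also have "\<dots> \<in> J \<tau>" using z(2,3) by (rule left_idealD(4)[OF left_ideal_J])
    finally show "z \<in> residue (a + b)" by (simp add: residue_def)
  next
    fix z assume z: "z \<in> residue (a + b)"
    have "z = frag_of (a, 1) + (z - frag_of (a, 1))" by simp
    moreover have "frag_of (a, 1) \<in> residue a"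
      by (simp add: residue_def left_idealD[OF left_ideal_J])
    moreover have "z - frag_of (a, 1) \<in> residue b"
      using z by (simp add: residue_def contract_diff algebra_simps)
    ultimately show "z \<in> {x + y | x y. x \<in> residue a \<and> y \<in> residue b}" by blast
  qed
  then show ?thesis by (simp add: principal_series_def extension_of_scalars_def)
qed

text \<open>The union in \<open>extension_of_scalars\<close> runs over all representatives of a
  coset; they all give the same coset because \<open>J \<tau>\<close> is a left ideal.\<close>

lemma P_act: "lm_act P h (residue a) = residue (h * a)"
proof -
  have "residue (h * contract x) = residue (h * a)" if "x \<in> residue a" for x
  proof -
    have "h * (contract x - a) \<in> J \<tau>"
      using that left_idealD(2)[OF left_ideal_J] by (simp add: residue_def)
    then show ?thesis by (simp add: residue_eq_iff right_diff_distrib)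
  qed
  moreover have "frag_of (a, 1) \<in> residue a"
    by (simp add: residue_def left_idealD[OF left_ideal_J])
  ultimately have "(\<Union>x\<in>residue a. residue (h * contract x)) = residue (h * a)" by blast
  then show ?thesis
    by (simp add: principal_series_def extension_of_scalars_def tensor_coset_eq contract_extend)
qed

text \<open>The correspondence theorem for the quotient by \<open>J \<tau>\<close>; the ideal
  belonging to N is its preimage under \<open>residue\<close>.\<close>

lemma submodule_P_iff:
  "Defs.submodule P N \<longleftrightarrow> (\<exists>M. left_ideal M \<and> J \<tau> \<subseteq> M \<and> N = residue ` M)"
proof
  assume N: "Defs.submodule P N"
  let ?M = "{h. residue h \<in> N}"
  have "left_ideal ?M"
    using N by (intro left_idealI) (auto simp: Defs.submodule_def P_zero simp flip: P_add P_act)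
  moreover have "J \<tau> \<subseteq> ?M"
  proof
    fix x assume "x \<in> J \<tau>"
    then have "residue x = residue 0" by (simp add: residue_eq_iff)
    then show "x \<in> ?M" using N by (simp add: Defs.submodule_def P_zero)
  qed
  moreover have "N = residue ` ?M"
    using N by (auto simp: Defs.submodule_def P_carrier)
  ultimately show "\<exists>M. left_ideal M \<and> J \<tau> \<subseteq> M \<and> N = residue ` M" by blast
next
  assume "\<exists>M. left_ideal M \<and> J \<tau> \<subseteq> M \<and> N = residue ` M"
  then show "Defs.submodule P N"
    by (auto simp: Defs.submodule_def P_carrier P_zero P_add P_act left_idealD)
qed

lemma residue_image_eq_iff:
  assumes "left_ideal M" "J \<tau> \<subseteq> M" "left_ideal M'" "J \<tau> \<subseteq> M'"
  shows "residue ` M = residue ` M' \<longleftrightarrow> M = M'"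
proof -
  have sub: "M \<subseteq> M'" if M: "residue ` M \<subseteq> residue ` M'" "left_ideal M'" "J \<tau> \<subseteq> M'" for M M'
  proof
    fix x assume "x \<in> M"
    then obtain y where y: "y \<in> M'" "residue x = residue y" using M(1) by blast
    then have "(x - y) + y \<in> M'"
      using M(3) by (intro left_idealD(4)[OF M(2)]) (auto simp: residue_eq_iff)
    then show "x \<in> M'" by simp
  qed
  show ?thesis
  proof
    assume "residue ` M = residue ` M'"
    then show "M = M'" using sub[of M M'] sub[of M' M] assms by (simp add: equalityI)
  qed simp
qed

lemma irreducible_P_iff:
  "irreducible_module P \<longleftrightarrow> J \<tau> \<noteq> UNIV \<and> (\<forall>M. left_ideal M \<and> J \<tau> \<subseteq> M \<longrightarrow> M = J \<tau> \<or> M = UNIV)"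
proof -
  have U: "left_ideal UNIV" by (rule left_idealI) simp_all
  have zero: "{lm_zero P} = residue ` J \<tau>"
  proof -
    have "residue x = residue 0" if "x \<in> J \<tau>" for x using that by (simp add: residue_eq_iff)
    then show ?thesis using left_idealD(3)[OF left_ideal_J] unfolding P_zero by blast
  qed
  note eq = residue_image_eq_iff[OF _ _ left_ideal_J subset_refl]
    residue_image_eq_iff[OF _ _ U subset_UNIV]
  show ?thesis
    unfolding irreducible_module_def zero P_carrier submodule_P_iff
    using eq U by (metis subset_UNIV)
qed

end

end

theorem corollary4p10:
  fixes S :: "('i, 'x::fg_free_abelian, 'y::fg_free_abelian) root_data"
    and \<sigma> \<sigma>' :: "'i \<Rightarrow> 'f::field_char_0"
    and scale :: "'f \<Rightarrow> 'h::ring_1 \<Rightarrow> 'h"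
    and ZH :: "'y \<Rightarrow> ('y \<Rightarrow> 'y) \<Rightarrow> 'h"
    and \<tau> :: "'y \<Rightarrow> 'f"
  assumes "root_generating_system S"
    and "hecke_parameters S \<sigma> \<sigma>'"
    and "\<forall>i\<in>index S. \<sigma>' i \<notin> {inverse (\<sigma> i), - \<sigma> i, - inverse (\<sigma> i)}"
    and "BL_hecke_algebra S \<sigma> \<sigma>' scale ZH"
    and "\<tau> \<in> torus"
    and regular: "\<forall>w\<in>weyl S - {id}. torus_act w \<tau> \<noteq> \<tau>"
  shows "irreducible_module (principal_series scale ZH \<tau>) \<longleftrightarrow> \<tau> \<in> \<U> S \<sigma> \<sigma>'"
proof -
  interpret BL_hecke S \<sigma> \<sigma>' scale ZH
    by unfold_locales (fact assms)+
  note reg = regularI[OF assms(5) regular]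
  have Q_zero: "Q_at i (\<tau> \<circ> inv w) = \<sigma> i \<longleftrightarrow> ga_eval (\<tau> \<circ> inv w) (zeta_num i) = 0"
    if "w \<in> W" "i \<in> I" for w i
    using Q_at_eq_sigma_iff[OF that(2)] regular_refl[OF regular_comp_inv[OF reg that(1)] that(2)]
    by blast
  \<comment> \<open>\<open>mem_U_iff\<close> composes \<tau> with w, the weights are compositions
    with inverses; inversion permutes \<open>W\<close>.\<close>
  have "\<tau> \<in> \<U> S \<sigma> \<sigma>' \<longleftrightarrow> (\<forall>w\<in>W. \<forall>i\<in>I. ga_eval (\<tau> \<circ> inv w) (zeta_num i) \<noteq> 0)"
    unfolding mem_U_iff[OF assms(5)] by (metis W_inverse inv_inv_eq)
  also have "\<dots> \<longleftrightarrow> (\<forall>w\<in>W. \<forall>i\<in>I. Q_at i (\<tau> \<circ> inv w) \<noteq> \<sigma> i)"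
    using Q_zero by blast
  also have "\<dots> \<longleftrightarrow> irreducible_module (principal_series scale ZH \<tau>)"
  proof
    assume Q: "\<forall>w\<in>W. \<forall>i\<in>I. Q_at i (\<tau> \<circ> inv w) \<noteq> \<sigma> i"
    have "1 \<notin> J \<tau>"
      using leading_notin_J[OF assms(5) id_in_W, of 1] by (simp add: Z_zero subspace_0)
    with J_maximal[OF reg Q] show "irreducible_module (principal_series scale ZH \<tau>)"
      unfolding irreducible_P_iff[OF assms(5)] by blast
  next
    assume "irreducible_module (principal_series scale ZH \<tau>)"
    then show "\<forall>w\<in>W. \<forall>i\<in>I. Q_at i (\<tau> \<circ> inv w) \<noteq> \<sigma> i"
      unfolding irreducible_P_iff[OF assms(5)] using J_not_maximal[OF reg] by metis
  qed
  finally show ?thesis by blast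
qed

end
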